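(* Let $F$ be a finite field of order $q$ and characteristic $p\neq 3$. Let $g$ be a non-constant monic square-free polynomial in $F[t]$. Then $$q^{N/3}\ll \vert \mathcal{U}_g\cap F[t]_{\leq N}\vert \ll N^2q^{N/3}$$ as $N\to\infty$, where the implied constants depend only on $F$ and $g$.
   Context: A polynomial in $F[t]$ is called square-free if it is not divisible by the square of a non-constant element of $F[t]$. For a field $K=F(t,\sqrt[3]{f})$ with $f\in F[t]$ cube-free (not divisible by the cube of a non-constant element of $F[t]$), let $\mathcal{O}_K$ be the integral closure of $F[t]$ in $K$; $K$ is called monogenic if $\mathcal{O}_K=F[t,\theta]$ for some $\theta\in\mathcal{O}_K$. For monic square-free $g\in F[t]$, let $\mathcal{U}_g$ be the set of square-free $h\in F[t]$ such that $\gcd(g,h)=1$ and $F(t,\sqrt[3]{g^2h})$ is monogenic. For each positive integer $N$, $F[t]_{\leq N}$ denotes the set of polynomials in $F[t]$ of degree at most $N$. The notation $A(N)\ll B(N)$ as $N\to\infty$ means $A(N)\le C\,B(N)$ for all sufficiently large $N$, for some positive constant $C$. *)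

theory Defs
  imports
    Complex_Main
    "HOL-Library.Cardinality"
    "HOL-Algebra.Algebraic_Closure_Type"
    "HOL-Algebra.Generated_Fields"
begin

text \<open>
  The type variable \<open>'a\<close> is the base field \<open>F\<close>, so \<open>'a poly\<close> is \<open>F[t]\<close> and \<open>'a poly fract\<close> is
  \<open>F(t)\<close>. All extensions of \<open>F(t)\<close> live inside its algebraic closure \<open>'a poly fract alg_closure\<close>.
\<close>

definition embed_poly :: "'a::field poly \<Rightarrow> 'a poly fract alg_closure" where
  "embed_poly p = to_ac (Fract p 1)"

text \<open>
  An arbitrary but fixed cube root. If \<open>f\<close> is not a cube in \<open>F(t)\<close>, then \<open>X\<^sup>3 - f\<close> is irreducible
  over \<open>F(t)\<close>, so that the choice does not affect the field \<open>F(t, cbrt f)\<close> up to isomorphism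
  over \<open>F(t)\<close>.
\<close>

definition cbrt :: "'a::field poly \<Rightarrow> 'a poly fract alg_closure" where
  "cbrt f = (SOME \<alpha>. \<alpha> ^ 3 = embed_poly f)"

definition cubic_field :: "'a::field poly \<Rightarrow> 'a poly fract alg_closure set" where
  "cubic_field f = generate_field ring_of_type_algebra (insert (cbrt f) (range to_ac))"

definition integral_over_poly :: "'a::field poly fract alg_closure \<Rightarrow> bool" where
  "integral_over_poly x \<longleftrightarrow>
     (\<exists>P :: 'a poly poly. lead_coeff P = 1 \<and> poly (map_poly embed_poly P) x = 0)"

definition integral_closure_in ::
    "'a::field poly fract alg_closure set \<Rightarrow> 'a poly fract alg_closure set" where
  "integral_closure_in K = {x \<in> K. integral_over_poly x}"

definition poly_ring_adjoin ::
    "'a::field poly fract alg_closure \<Rightarrow> 'a poly fract alg_closure set" where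
  "poly_ring_adjoin \<theta> = range (\<lambda>P :: 'a poly poly. poly (map_poly embed_poly P) \<theta>)"

definition monogenic :: "'a::field poly fract alg_closure set \<Rightarrow> bool" where
  "monogenic K \<longleftrightarrow>
     (\<exists>\<theta> \<in> integral_closure_in K. integral_closure_in K = poly_ring_adjoin \<theta>)"

text \<open>
  The library's \<open>squarefree\<close> excludes \<open>0\<close> and admits the nonzero constants; the elements of
  \<open>monogenic_set g\<close> are not required to be monic.
\<close>

definition monogenic_set :: "'a::field poly \<Rightarrow> 'a poly set" where
  "monogenic_set g = {h. squarefree h \<and> coprime g h \<and> monogenic (cubic_field (g\<^sup>2 * h))}"

end

theory Submission
  imports Defs
begin

text \<open>
  Write \<open>A = F[t]\<close>, let \<open>\<alpha>\<close> be a cube root of \<open>g\<^sup>2 h\<close> and \<open>\<beta> = \<alpha>\<^sup>2 / g\<close>, a cube root of \<open>g h\<^sup>2\<close>.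
  As \<open>3\<close> is invertible and \<open>g\<close>, \<open>h\<close> are square-free and coprime, \<open>1, \<alpha>, \<beta>\<close> is an \<open>A\<close>-basis of the
  integral closure. With respect to it, the powers \<open>1, \<theta>, \<theta>\<^sup>2\<close> of \<open>\<theta> = a + x \<alpha> + y \<beta>\<close> have
  determinant \<open>g x\<^sup>3 - h y\<^sup>3\<close>. Hence the field is monogenic iff the Thue equation
  \<open>g x\<^sup>3 - h y\<^sup>3 = c\<close> has a solution with \<open>x, y \<in> A\<close> and a nonzero constant \<open>c\<close>
  (\<open>monogenic_cubic_field_iff\<close>), and the theorem is about the number of such \<open>h\<close>.

  Upper bound. Suppose that \<open>deg h > deg g\<close>. Differentiating \<open>g x\<^sup>3 = h y\<^sup>3 + c\<close> gives
  \<open>x\<^sup>2 (g' x + 3 g x') = y\<^sup>2 (h' y + 3 h y')\<close>, and \<open>x\<close>, \<open>y\<close> are coprime, so \<open>y\<^sup>2\<close> divides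
  \<open>g' x + 3 g x'\<close>. Unless that vanishes, comparing degrees yields \<open>3 deg y < 2 deg g + deg h\<close>.
  If it vanishes, both sides of the equation are \<open>p\<close>-th powers; their roots satisfy an
  equation of the same kind with smaller degrees, possibly with \<open>g\<^sup>2\<close>, \<open>h\<^sup>2\<close> in place of \<open>g\<close>, \<open>h\<close>,
  and for a separable solution of this second kind the same computation contradicts
  \<open>deg h > deg g\<close>. So, up to finitely many, every \<open>h\<close> of degree at most \<open>N\<close> comes from a solution with
  \<open>y\<close> of degree at most about \<open>N / 3\<close> (\<open>exists_small_solution\<close>). For fixed \<open>c\<close> and \<open>y\<close>, the condition
  \<open>y\<^sup>3 | g x\<^sup>3 - c\<close> confines \<open>x\<close> to at most \<open>3^\<omega>(y)\<close> residue classes modulo \<open>y\<^sup>3\<close>, where \<open>\<omega>(y)\<close> is the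
  number of prime divisors. This is at most the number of factorisations \<open>y = a b c\<close> into monic
  polynomials, whose sum over the monic \<open>y\<close> of degree \<open>d\<close> is at most \<open>(d + 1)\<^sup>2 q\<^sup>d\<close>. Summing over \<open>d\<close> gives
  \<open>N\<^sup>2 q^(N/3)\<close> (\<open>solvable_set_upper_bound\<close>).

  Lower bound. Taking \<open>y = 1\<close>, every square-free value of \<open>g x\<^sup>3 + 1\<close> is a suitable \<open>h\<close>. It is enough to
  use \<open>x = Q z\<close> for a fixed \<open>Q\<close>, chosen such that \<open>G = g Q\<^sup>3\<close> is a \<open>p\<close>-th power and divisible by all
  nonzero polynomials of degree at most \<open>3\<close>. Then no prime of degree at most \<open>3\<close> divides \<open>G z\<^sup>3 + 1\<close>, and the
  squares of the primes of degree between \<open>4\<close> and \<open>m / 2\<close> spoil at most \<open>3/8\<close> of the monic \<open>z\<close> of degree \<open>m\<close>,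
  by a union bound. If the square of a larger prime \<open>P\<close> divides \<open>G z\<^sup>3 + 1\<close>, then \<open>P\<close>
  divides \<open>z'\<close>, since \<open>G' = 0\<close>; if \<open>z' \<noteq> 0\<close>, this determines \<open>P\<close> up to a constant,
  as \<open>deg P > m / 2\<close>. The shifts \<open>z + v\<^sup>p\<close> have the same derivative as \<open>z\<close>, and at most three of those with small \<open>v\<close> are cube roots of \<open>-1/G\<close> modulo \<open>P\<close>,
  so large primes spoil a negligible proportion of the \<open>z\<close> (\<open>card_squarefree_values\<close>).
\<close>

section \<open>Prime polynomials, squarefreeness and the characteristic\<close>

lemma not_is_unit_iff_degree_pos:
  fixes p :: "'a::field poly"
  assumes "p \<noteq> 0"
  shows "\<not> is_unit p \<longleftrightarrow> degree p > 0"
  by (subst is_unit_iff_degree[OF assms]) simp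

lemma exists_prime_elem_dvd_poly:
  fixes p :: "'a::field poly"
  assumes "degree p > 0"
  obtains P where "prime_elem P" "P dvd p"
proof -
  have "\<exists>P. prime_elem P \<and> P dvd p"
    using assms
  proof (induction "degree p" arbitrary: p rule: less_induct)
    case less
    show ?case
    proof (cases "irreducible p")
      case True
      then show ?thesis using field_poly_irreducible_imp_prime[OF True] by (intro exI[of _ p]) simp
    next
      case False
      have "p \<noteq> 0" using less.prems by auto
      moreover have "\<not> is_unit p"
        using less.prems by (subst not_is_unit_iff_degree_pos[OF \<open>p \<noteq> 0\<close>])
      ultimately obtain a b where ab: "p = a * b" "\<not> is_unit a" "\<not> is_unit b"
        using False unfolding irreducible_def by auto
      with \<open>p \<noteq> 0\<close> have "a \<noteq> 0" "b \<noteq> 0" by auto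
      with ab have "degree a > 0" "degree b > 0"
        by (metis not_is_unit_iff_degree_pos)+
      moreover have "degree p = degree a + degree b"
        using ab \<open>a \<noteq> 0\<close> \<open>b \<noteq> 0\<close> by (simp add: degree_mult_eq)
      ultimately obtain P where "prime_elem P" "P dvd a"
        using less.hyps[of a] by auto
      then show ?thesis using ab by auto
    qed
  qed
  with that show ?thesis by blast
qed

lemma prime_elem_degree_pos:
  fixes P :: "'a::field poly"
  assumes "prime_elem P"
  shows "degree P > 0"
  using assms by (metis not_is_unit_iff_degree_pos prime_elem_def)

lemma exists_monic_prime_elem_dvd_poly:
  fixes p :: "'a::field poly"
  assumes "degree p > 0"
  obtains P where "prime_elem P" "lead_coeff P = 1" "P dvd p"
proof -
  obtain P0 where P0: "prime_elem P0" "P0 dvd p"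
    using assms by (rule exists_prime_elem_dvd_poly)
  define P where "P = smult (inverse (lead_coeff P0)) P0"
  have l0: "lead_coeff P0 \<noteq> 0" using P0 by auto
  have "P = [:inverse (lead_coeff P0):] * P0" by (simp add: P_def)
  moreover have "is_unit [:inverse (lead_coeff P0):]" using l0 by (simp add: is_unit_triv)
  ultimately have "prime_elem P" using P0(1) by (simp only: prime_elem_mult_unit_left)
  moreover have "lead_coeff P = 1" using l0 by (simp add: P_def)
  moreover have "P dvd p" using P0(2) l0 by (simp add: P_def smult_dvd_iff)
  ultimately show thesis by (rule that)
qed

lemma prime_elem_power_dvd_mult_cancel:
  fixes P :: "'a::idom"
  assumes "prime_elem P" "\<not> P dvd a" "P ^ k dvd a * b"
  shows "P ^ k dvd b"
  using assms(3)
proof (induction k arbitrary: b)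
  case (Suc k)
  have "P dvd a * b" using Suc.prems dvd_trans[of P "P ^ Suc k"] by simp
  with assms(1,2) have "P dvd b" by (auto dest: prime_elem_dvd_multD)
  then obtain c where c: "b = P * c" by blast
  from Suc.prems c have "P * P ^ k dvd P * (a * c)" by (simp add: mult_ac)
  moreover have "P \<noteq> 0" using assms(1) by auto
  ultimately have "P ^ k dvd a * c" by (simp add: dvd_mult_cancel_left)
  from Suc.IH[OF this] c show ?case by simp
qed simp

text \<open>
  This replaces a comparison of multiplicities, as \<open>3 v(u) \<le> 2 + 3 v(w)\<close> forces \<open>v(u) \<le> v(w)\<close>. It
  serves to clear denominators and to extract \<open>p\<close>-th roots up to cubes.
\<close>

lemma dvd_of_cube_dvd_cubefree_mult_cube:
  fixes f u w :: "'a::field poly"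
  assumes "\<And>P. prime_elem P \<Longrightarrow> \<not> P ^ 3 dvd f"
  assumes "u ^ 3 dvd f * w ^ 3" "u \<noteq> 0"
  shows "u dvd w"
  using assms(2,3)
proof (induction "degree u" arbitrary: u w rule: less_induct)
  case less
  show ?case
  proof (cases "degree u = 0")
    case True
    then show ?thesis using less.prems(2) is_unit_iff_degree by blast
  next
    case False
    then have "degree u > 0" by simp
    then obtain P where P: "prime_elem P" "P dvd u" by (rule exists_prime_elem_dvd_poly)
    have P0: "P \<noteq> 0" using P by auto
    from P obtain u' where u': "u = P * u'" by blast
    have "P ^ 3 dvd w ^ 3 * f"
      using less.prems(1) u' by (metis dvd_mult_left mult.commute power_mult_distrib)
    then have "P dvd w"
      using prime_elem_power_dvd_mult_cancel[OF P(1), of "w ^ 3" 3 f] assms(1)[OF P(1)]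
        P(1) prime_elem_dvd_power by blast
    then obtain w' where w': "w = P * w'" by blast
    have "P ^ 3 * u' ^ 3 dvd P ^ 3 * (f * w' ^ 3)"
      using less.prems(1) u' w' by (simp add: power_mult_distrib mult_ac)
    then have "u' ^ 3 dvd f * w' ^ 3"
      using P0 by (simp add: dvd_mult_cancel_left)
    moreover have "u' \<noteq> 0" using u' less.prems(2) by auto
    moreover have "degree u' < degree u"
      using u' P0 \<open>u' \<noteq> 0\<close> prime_elem_degree_pos[OF P(1)] by (simp add: degree_mult_eq)
    ultimately have "u' dvd w'" using less.hyps by blast
    then show ?thesis using u' w' by simp
  qed
qed

lemma squarefree_not_prime_square_dvd:
  assumes "squarefree g" "prime_elem P"
  shows "\<not> P\<^sup>2 dvd g"
  using assms by (auto simp: squarefree_def prime_elem_def)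

lemma squarefree_power_cubefree:
  fixes g :: "'a::field poly"
  assumes "squarefree g" "e \<le> 2" "prime_elem P"
  shows "\<not> P ^ 3 dvd g ^ e"
proof
  assume *: "P ^ 3 dvd g ^ e"
  have P0: "P \<noteq> 0" using assms by auto
  have g0: "g \<noteq> 0" using assms(1) by auto
  have "g ^ e dvd g ^ 2" using assms(2) by (rule le_imp_power_dvd)
  with * have *: "P ^ 3 dvd g ^ 2" by (rule dvd_trans)
  have "P dvd P ^ 3" by (simp add: power3_eq_cube)
  then have "P dvd g ^ 2" using * by (rule dvd_trans)
  then have "P dvd g" using assms(3) prime_elem_dvd_power by blast
  then obtain a where a: "g = P * a" by blast
  have "\<not> P dvd a"
    using squarefree_not_prime_square_dvd[OF assms(1,3)] a by (auto simp: power2_eq_square)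
  moreover have "P\<^sup>2 * P dvd P\<^sup>2 * a\<^sup>2" using * a
    by (simp add: power_mult_distrib power3_eq_cube power2_eq_square mult_ac)
  then have "P dvd a\<^sup>2" using P0 by (simp add: dvd_mult_cancel_left)
  ultimately show False using assms(3) prime_elem_dvd_power by blast
qed

lemma three_neq_0:
  assumes "CHAR('a::field) \<noteq> 3"
  shows "(3 :: 'a) \<noteq> 0"
proof
  assume "(3::'a) = 0"
  then have "of_nat 3 = (0::'a)" by simp
  then have "CHAR('a) dvd 3" by (simp only: of_nat_eq_0_iff_char_dvd)
  then have "CHAR('a) = 1 \<or> CHAR('a) = 3"
    using prime_nat_iff[of "3::nat"] by auto
  with assms CHAR_not_1'[where 'a='a] show False by simp
qed

lemma prime_elem_not_dvd_3:
  fixes P :: "'a::field poly"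
  assumes "CHAR('a) \<noteq> 3" "prime_elem P"
  shows "\<not> P dvd 3"
proof -
  have 3: "(3 :: 'a poly) = [:3:]" by (simp add: numeral_poly)
  have "is_unit (3 :: 'a poly)"
    unfolding 3 using three_neq_0[OF assms(1)] by (rule is_unit_triv)
  then show ?thesis using assms(2) by (auto simp: prime_elem_def dest: dvd_unit_imp_unit)
qed

lemma pderiv_cube:
  fixes z :: "'a::idom poly"
  shows "pderiv (z ^ 3) = smult 3 (z\<^sup>2) * pderiv z"
  using pderiv_power_Suc[of z 2] by (simp add: eval_nat_numeral)

lemma prime_CHAR_finite: "prime CHAR('a::{field,finite})"
  by (rule prime_CHAR_semidom) (rule finite_imp_CHAR_pos, simp)

lemma not_3_dvd_CHAR:
  assumes "CHAR('a::{field,finite}) \<noteq> 3"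
  shows "\<not> 3 dvd CHAR('a)"
proof
  assume "3 dvd CHAR('a)"
  moreover have "prime (3 :: nat)" by simp
  ultimately show False
    using primes_dvd_imp_eq[of 3 "CHAR('a)"] prime_CHAR_finite[where 'a = 'a] assms by simp
qed

text \<open>
  Thus \<open>p\<close> is its own inverse modulo \<open>3\<close>, which makes extraction of \<open>p\<close>-th roots possible up to cubes.
\<close>

lemma square_eq_1_mod_3:
  fixes p :: nat
  assumes "\<not> 3 dvd p"
  obtains s where "p * p = s * 3 + 1"
proof -
  have "p mod 3 = 1 \<or> p mod 3 = 2" using assms by presburger
  moreover have "p * p mod 3 = (p mod 3) * (p mod 3) mod 3" by (simp add: mod_mult_eq)
  ultimately have "p * p mod 3 = 1" by auto
  then show thesis using that[of "p * p div 3"] by (metis div_mult_mod_eq)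
qed

section \<open>Fractions of polynomials and Gauss's lemma\<close>

lemma embed_poly_eq: "embed_poly p = to_ac (to_fract p)"
  by (simp add: embed_poly_def to_fract_def)

lemma embed_poly_simps [simp]:
  "embed_poly 0 = 0" "embed_poly 1 = 1"
  "embed_poly (p + q) = embed_poly p + embed_poly q"
  "embed_poly (p - q) = embed_poly p - embed_poly q"
  "embed_poly (- p) = - embed_poly p"
  "embed_poly (p * q) = embed_poly p * embed_poly q"
  "embed_poly p = embed_poly q \<longleftrightarrow> p = q"
  "embed_poly p = 0 \<longleftrightarrow> p = 0"
  by (simp_all add: embed_poly_eq)

lemma to_fract_power: "to_fract (x ^ n) = to_fract x ^ n"
  by (induction n) simp_all

lemma embed_poly_power [simp]: "embed_poly (p ^ n) = embed_poly p ^ n"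
  by (induction n) simp_all

lemma to_fract_numeral [simp]: "to_fract (numeral n) = numeral n"
proof -
  have "to_fract (of_nat m) = of_nat m" for m
    by (induction m) simp_all
  from this[of "numeral n"] show ?thesis by simp
qed

lemma map_poly_hom_mult:
  fixes f :: "'a::comm_semiring_1 \<Rightarrow> 'b::comm_semiring_1"
  assumes "f 0 = 0" "\<And>x y. f (x + y) = f x + f y" "\<And>x y. f (x * y) = f x * f y"
  shows "map_poly f (p * q) = map_poly f p * map_poly f q"
proof -
  have "f (sum u A) = (\<Sum>x\<in>A. f (u x))" for u :: "nat \<Rightarrow> 'a" and A
    by (induction A rule: infinite_finite_induct) (simp_all add: assms)
  then show ?thesis
    by (intro poly_eqI) (simp add: coeff_map_poly assms coeff_mult)
qed

lemma map_poly_hom_add: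
  assumes "f 0 = 0" "\<And>x y. f (x + y) = f x + f y"
  shows "map_poly f (p + q) = map_poly f p + map_poly f q"
  by (intro poly_eqI) (simp add: coeff_map_poly assms)

lemma common_denominator_fract:
  fixes a b c :: "'a::idom fract"
  obtains a' b' c' d where "d \<noteq> 0" "a = to_fract a' / to_fract d"
    "b = to_fract b' / to_fract d" "c = to_fract c' / to_fract d"
proof -
  obtain a1 a2 where a: "a = Fract a1 a2" "a2 \<noteq> 0" by (cases a)
  obtain b1 b2 where b: "b = Fract b1 b2" "b2 \<noteq> 0" by (cases b)
  obtain c1 c2 where c: "c = Fract c1 c2" "c2 \<noteq> 0" by (cases c)
  show thesis
    by (rule that[of "a2 * b2 * c2" "a1 * b2 * c2" "b1 * a2 * c2" "c1 * a2 * b2"])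
      (use a b c in \<open>simp_all add: Fract_conv_to_fract\<close>)
qed

text \<open>
  The form is the norm from the cubic field. At a prime \<open>P\<close> that divides \<open>g\<close> exactly once and not \<open>h\<close>,
  the valuations of the terms \<open>a\<^sup>3\<close>, \<open>b\<^sup>3 g\<^sup>2 h\<close>, \<open>c\<^sup>3 g h\<^sup>2\<close> are pairwise incongruent modulo \<open>3\<close>, and
  the mixed term exceeds their minimum. Instead of valuations the proof uses infinite descent: \<open>P\<close>
  divides \<open>a\<close>, then \<open>c\<close>, then \<open>b\<close>, and \<open>P\<^sup>3\<close> cancels.
\<close>

lemma norm_form_eq_0_imp:
  fixes g h a b c :: "'a::field poly"
  assumes "prime_elem P" "P dvd g" "\<not> P\<^sup>2 dvd g" "\<not> P dvd h"
    and "a ^ 3 + b ^ 3 * g\<^sup>2 * h + c ^ 3 * g * h\<^sup>2 = 3 * a * b * c * g * h"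
  shows "a = 0 \<and> b = 0 \<and> c = 0"
  using assms(5)
proof (induction "degree a + degree b + degree c" arbitrary: a b c rule: less_induct)
  case less
  have P0: "P \<noteq> 0" using assms(1) by auto
  obtain k where k: "g = P * k" using assms(2) by blast
  have Pk: "\<not> P dvd k" using assms(3) k by (auto simp: power2_eq_square)
  have "a ^ 3 = P * (3 * a * b * c * k * h - b ^ 3 * P * k\<^sup>2 * h - c ^ 3 * k * h\<^sup>2)"
  proof -
    have "a ^ 3 = 3 * a * b * c * g * h - b ^ 3 * g\<^sup>2 * h - c ^ 3 * g * h\<^sup>2"
      using less.prems by (simp add: algebra_simps)
    also have "\<dots> = P * (3 * a * b * c * k * h - b ^ 3 * P * k\<^sup>2 * h - c ^ 3 * k * h\<^sup>2)"
      unfolding k by (simp add: algebra_simps power2_eq_square power3_eq_cube)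
    finally show ?thesis .
  qed
  then have "P dvd a ^ 3" by simp
  then obtain a' where a': "a = P * a'" using assms(1) prime_elem_dvd_power by blast
  have "P * (c ^ 3 * (k * h\<^sup>2)) = P * (P * (3 * a' * b * c * k * h - b ^ 3 * k\<^sup>2 * h - P * a' ^ 3))"
  proof -
    have "c ^ 3 * g * h\<^sup>2 = 3 * a * b * c * g * h - b ^ 3 * g\<^sup>2 * h - a ^ 3"
      using less.prems by (simp add: algebra_simps)
    then show ?thesis
      unfolding k a' by (simp add: algebra_simps power2_eq_square power3_eq_cube)
  qed
  then have "c ^ 3 * (k * h\<^sup>2) = P * (3 * a' * b * c * k * h - b ^ 3 * k\<^sup>2 * h - P * a' ^ 3)"
    using P0 by (simp only: mult_cancel_left) simp
  then have "P dvd c ^ 3 * (k * h\<^sup>2)" by simp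
  then have "P dvd c"
    using assms(1,4) Pk by (simp add: prime_elem_dvd_mult_iff prime_elem_dvd_power_iff)
  then obtain c' where c': "c = P * c'" by blast
  have "P\<^sup>2 * (b ^ 3 * (k\<^sup>2 * h)) = P\<^sup>2 * (P * (3 * a' * b * c' * k * h - P * c' ^ 3 * k * h\<^sup>2 - a' ^ 3))"
  proof -
    have "b ^ 3 * g\<^sup>2 * h = 3 * a * b * c * g * h - c ^ 3 * g * h\<^sup>2 - a ^ 3"
      using less.prems by (simp add: algebra_simps)
    then show ?thesis
      unfolding k a' c' by (simp add: algebra_simps power2_eq_square power3_eq_cube)
  qed
  then have "b ^ 3 * (k\<^sup>2 * h) = P * (3 * a' * b * c' * k * h - P * c' ^ 3 * k * h\<^sup>2 - a' ^ 3)"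
    using P0 by (simp only: mult_cancel_left) simp
  then have "P dvd b ^ 3 * (k\<^sup>2 * h)" by simp
  then have "P dvd b"
    using assms(1,4) Pk by (simp add: prime_elem_dvd_mult_iff prime_elem_dvd_power_iff)
  then obtain b' where b': "b = P * b'" by blast
  have "P ^ 3 * (a' ^ 3 + b' ^ 3 * g\<^sup>2 * h + c' ^ 3 * g * h\<^sup>2) = P ^ 3 * (3 * a' * b' * c' * g * h)"
    using less.prems unfolding a' b' c' by (simp add: algebra_simps power2_eq_square power3_eq_cube)
  then have eq: "a' ^ 3 + b' ^ 3 * g\<^sup>2 * h + c' ^ 3 * g * h\<^sup>2 = 3 * a' * b' * c' * g * h"
    using P0 by (simp only: mult_cancel_left) simp
  show ?case
  proof (rule ccontr)
    assume *: "\<not> ?thesis"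
    have le: "degree (P * x) \<ge> degree x" "x \<noteq> 0 \<Longrightarrow> degree (P * x) > degree x" for x
      using P0 prime_elem_degree_pos[OF assms(1)] by (cases "x = 0"; simp add: degree_mult_eq)+
    have "a' \<noteq> 0 \<or> b' \<noteq> 0 \<or> c' \<noteq> 0" using * a' b' c' by auto
    then have "degree a' + degree b' + degree c' < degree a + degree b + degree c"
      using le[of a'] le[of b'] le[of c'] unfolding a' b' c' by (auto simp: add_less_le_mono add_le_less_mono add_mono)
    from less.hyps[OF this eq] * a' b' c' show False by simp
  qed
qed

text \<open>
  Gauss's lemma in the form that is needed for integral closedness: a prime of \<open>F[t]\<close> stays prime
  in \<open>F[t][X]\<close>, so the prime factors of \<open>e\<close> can be cancelled one at a time against \<open>Q\<close> or \<open>R\<close> until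
  the leading coefficients of both are units.
\<close>

lemma monic_poly_factor_lead_dvd:
  fixes P Q R :: "'a::field poly poly"
  assumes "lead_coeff P = 1" "e \<noteq> 0" "smult e P = Q * R"
  shows "[:lead_coeff Q:] dvd Q"
  using assms(2,3)
proof (induction "degree e" arbitrary: e Q R rule: less_induct)
  case less
  have P0: "P \<noteq> 0" using assms(1) by auto
  have "lead_coeff (smult e P) = lead_coeff Q * lead_coeff R"
    using less.prems by (simp add: lead_coeff_mult)
  then have e: "e = lead_coeff Q * lead_coeff R" using assms(1) less.prems(1) by simp
  show ?case
  proof (cases "degree e = 0")
    case True
    then have "is_unit e" using less.prems(1) is_unit_iff_degree by blast
    moreover have "lead_coeff Q dvd e" using e by simp
    ultimately have "is_unit (lead_coeff Q)" by (rule dvd_unit_imp_unit[rotated])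
    then have "is_unit [:lead_coeff Q:]" by (simp add: is_unit_const_poly_iff)
    then show ?thesis by (rule unit_imp_dvd)
  next
    case False
    then have "degree e > 0" by simp
    then obtain p where p: "prime_elem p" "p dvd e" by (rule exists_prime_elem_dvd_poly)
    obtain e' where e': "e = p * e'" using p by blast
    have p0: "p \<noteq> 0" using p by auto
    have e'0: "e' \<noteq> 0" using e' less.prems by auto
    have deg: "degree e' < degree e"
      using e' p0 e'0 prime_elem_degree_pos[OF p(1)] by (simp add: degree_mult_eq)
    have "prime_elem [:p:]" using p(1) by (rule lift_prime_elem_poly)
    moreover have eq: "[:p:] * smult e' P = Q * R"
      using less.prems(2) e' by (simp add: mult.commute)
    then have "[:p:] dvd Q * R" by (rule dvdI[OF sym])
    ultimately consider "[:p:] dvd Q" | "[:p:] dvd R" by (auto dest: prime_elem_dvd_multD)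
    then show ?thesis
    proof cases
      case 1
      then obtain Q' where Q': "Q = [:p:] * Q'" by blast
      have "[:p:] * smult e' P = [:p:] * (Q' * R)" using eq Q' by (simp only: mult.assoc)
      then have "smult e' P = Q' * R"
        using p0 by (simp only: mult_cancel_left) simp
      from less.hyps[OF deg e'0 this] have "[:lead_coeff Q':] dvd Q'" .
      then have "[:p:] * [:lead_coeff Q':] dvd [:p:] * Q'" by (rule mult_dvd_mono[OF dvd_refl])
      moreover have "[:p:] * [:lead_coeff Q':] = [:lead_coeff Q:]"
        unfolding Q' by simp
      ultimately have "[:lead_coeff Q:] dvd [:p:] * Q'" by (simp only:)
      then show ?thesis by (simp only: Q'[symmetric])
    next
      case 2
      then obtain R' where R': "R = [:p:] * R'" by blast
      have "[:p:] * smult e' P = [:p:] * (Q * R')" using eq R' by (simp only: mult_ac)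
      then have "smult e' P = Q * R'"
        using p0 by (simp only: mult_cancel_left) simp
      from less.hyps[OF deg e'0 this] show ?thesis .
    qed
  qed
qed

lemma fract_poly_clear_denominators:
  fixes q :: "'a::idom fract poly"
  obtains d q' where "d \<noteq> 0" "smult (to_fract d) q = map_poly to_fract q'"
proof -
  have "\<exists>d q'. d \<noteq> 0 \<and> smult (to_fract d) q = map_poly to_fract q'"
  proof (induction q)
    case 0
    show ?case by (intro exI[of _ 1] exI[of _ 0]) simp
  next
    case (pCons a q)
    then obtain d q' where dq: "d \<noteq> 0" "smult (to_fract d) q = map_poly to_fract q'" by blast
    obtain a1 a2 where a: "a = Fract a1 a2" "a2 \<noteq> 0" by (cases a)
    have "smult (to_fract (a2 * d)) (pCons a q) = map_poly to_fract (pCons (a1 * d) (smult a2 q'))"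
      using a dq by (simp add: map_poly_pCons Fract_conv_to_fract flip: dq(2))
    then show ?case using dq(1) a(2) by (intro exI[of _ "a2 * d"] exI) auto
  qed
  with that show ?thesis by blast
qed

lemma monic_factor_of_monic_integral:
  fixes P :: "'a::field poly poly" and q :: "'a poly fract poly"
  assumes "lead_coeff P = 1" "lead_coeff q = 1" "q dvd map_poly to_fract P"
  shows "\<exists>q'. q = map_poly to_fract q'"
proof -
  obtain r where r: "map_poly to_fract P = q * r" using assms(3) by blast
  obtain d Q where Q: "d \<noteq> 0" "smult (to_fract d) q = map_poly to_fract Q"
    by (rule fract_poly_clear_denominators)
  obtain e R where R: "e \<noteq> 0" "smult (to_fract e) r = map_poly to_fract R"
    by (rule fract_poly_clear_denominators)
  have "map_poly to_fract (smult (d * e) P) = map_poly to_fract (Q * R)"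
    by (simp add: r mult.commute flip: Q(2) R(2))
  then have eq: "smult (d * e) P = Q * R" by (simp only: fract_poly_eq_iff)
  have "lead_coeff (map_poly to_fract Q) = to_fract d"
    using assms(2) by (simp flip: Q(2))
  then have lead: "lead_coeff Q = d"
    by (simp add: degree_map_poly coeff_map_poly)
  have "d * e \<noteq> 0" using Q R by simp
  from monic_poly_factor_lead_dvd[OF assms(1) this eq] lead
  obtain q' where "Q = [:d:] * q'" by (auto elim: dvdE)
  then have "smult (to_fract d) q = smult (to_fract d) (map_poly to_fract q')"
    using Q(2) by simp
  then have "q = map_poly to_fract q'" using Q(1) by (simp add: smult_eq_iff)
  then show ?thesis ..
qed

lemma integral_fract_is_poly:
  fixes P :: "'a::field poly poly"
  assumes "lead_coeff P = 1" "poly (map_poly to_fract P) x = 0"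
  shows "\<exists>z. x = to_fract z"
proof -
  have "[:- x, 1:] dvd map_poly to_fract P" using assms(2) by (simp add: poly_eq_0_iff_dvd)
  from monic_factor_of_monic_integral[OF assms(1) _ this]
  obtain q where "[:- x, 1:] = map_poly to_fract q" by auto
  then have "coeff [:- x, 1:] 0 = to_fract (coeff q 0)" by (simp add: coeff_map_poly)
  then have "x = to_fract (- coeff q 0)" by (simp add: minus_equation_iff[of x] eq_commute)
  then show ?thesis ..
qed

text \<open>
  A denominator of \<open>x\<close> would enter \<open>x\<^sup>3\<close> with multiplicity at least \<open>3\<close>, too much for the cube-free
  polynomial \<open>f\<close> to cancel.
\<close>

lemma fract_of_cube_mult_cubefree:
  fixes x :: "'a::field poly fract"
  assumes "\<And>P. prime_elem P \<Longrightarrow> \<not> P ^ 3 dvd f" "x ^ 3 * to_fract f = to_fract y"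
  shows "\<exists>z. x = to_fract z"
proof -
  obtain u v where uv: "x = Fract u v" "v \<noteq> 0" by (cases x)
  then have "to_fract u = x * to_fract v" by (simp add: Fract_conv_to_fract)
  then have "to_fract u ^ 3 * to_fract f = to_fract v ^ 3 * to_fract y"
    by (simp add: power_mult_distrib flip: assms(2))
  then have "to_fract (u ^ 3 * f) = to_fract (v ^ 3 * y)" by (simp add: to_fract_power)
  then have "v ^ 3 * y = f * u ^ 3" by (simp only: to_fract_eq_iff mult_ac)
  then have "v ^ 3 dvd f * u ^ 3" by (metis dvd_triv_left)
  from dvd_of_cube_dvd_cubefree_mult_cube[OF assms(1) this uv(2)]
  obtain z where "u = v * z" by blast
  with uv show ?thesis by (auto simp: Fract_conv_to_fract)
qed

lemma ring_of_type_algebra_inverses: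
  fixes x :: "'b::field"
  shows "a_inv ring_of_type_algebra x = - x" "x \<noteq> 0 \<Longrightarrow> m_inv ring_of_type_algebra x = inverse x"
proof -
  interpret F: field "ring_of_type_algebra :: 'b ring" by (rule field_from_type_algebra)
  show "a_inv ring_of_type_algebra x = - x"
    by (rule F.minus_equality) (simp_all add: ring_of_type_algebra_def)
  show "x \<noteq> 0 \<Longrightarrow> m_inv ring_of_type_algebra x = inverse x"
    by (rule F.inv_unique'[symmetric]) (simp_all add: ring_of_type_algebra_def)
qed

lemma map_poly_embed_pCons:
  "map_poly embed_poly (pCons s P) = pCons (embed_poly s) (map_poly embed_poly P)"
  by (rule map_poly_pCons) simp

section \<open>The pure cubic field and its ring of integers\<close>

text \<open>
  The cube root \<open>\<alpha>\<close> is a parameter, so that nothing depends on which of the three roots is chosen.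
\<close>

locale pure_cubic =
  fixes g h :: "'a::field poly" and \<alpha> :: "'a poly fract alg_closure"
  assumes char_neq_3: "CHAR('a) \<noteq> 3"
    and degree_g: "degree g > 0"
    and squarefree_g: "squarefree g"
    and squarefree_h: "squarefree h"
    and coprime_g_h: "coprime g h"
    and alpha_cube: "\<alpha> ^ 3 = embed_poly (g\<^sup>2 * h)"
begin

definition \<beta> :: "'a poly fract alg_closure" where
  "\<beta> = \<alpha>\<^sup>2 / embed_poly g"

definition elt :: "'a poly fract \<Rightarrow> 'a poly fract \<Rightarrow> 'a poly fract \<Rightarrow> 'a poly fract alg_closure" where
  "elt a b c = to_ac a + to_ac b * \<alpha> + to_ac c * \<beta>"

abbreviation "G \<equiv> to_fract g"
abbreviation "H \<equiv> to_fract h"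

lemma g_nz: "g \<noteq> 0" and h_nz: "h \<noteq> 0"
  using squarefree_g squarefree_h by auto

lemma alpha_alpha: "\<alpha> * \<alpha> = to_ac G * \<beta>"
  using g_nz by (simp add: \<beta>_def embed_poly_eq power2_eq_square)

lemma alpha_beta: "\<alpha> * \<beta> = to_ac (G * H)"
proof -
  have "\<alpha> * \<beta> = \<alpha> ^ 3 / embed_poly g"
    by (simp add: \<beta>_def power2_eq_square power3_eq_cube)
  also have "\<dots> = to_ac (G * H)"
    using g_nz unfolding alpha_cube by (simp add: embed_poly_eq power2_eq_square)
  finally show ?thesis .
qed

lemma beta_beta: "\<beta> * \<beta> = to_ac H * \<alpha>"
proof -
  have "to_ac G * (\<beta> * \<beta>) = \<alpha> * (\<alpha> * \<beta>)"
    using alpha_alpha by (simp add: mult_ac)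
  also have "\<dots> = to_ac G * (to_ac H * \<alpha>)"
    by (simp add: alpha_beta mult_ac)
  finally show ?thesis using g_nz by simp
qed

lemma elt_add: "elt a b c + elt a' b' c' = elt (a + a') (b + b') (c + c')"
  by (simp add: elt_def algebra_simps)

lemma elt_diff: "elt a b c - elt a' b' c' = elt (a - a') (b - b') (c - c')"
  by (simp add: elt_def algebra_simps)

lemma elt_uminus: "- elt a b c = elt (- a) (- b) (- c)"
  by (simp add: elt_def algebra_simps)

lemma elt_mult: "elt a b c * elt a' b' c' =
  elt (a * a' + (b * c' + c * b') * G * H) (a * b' + b * a' + c * c' * H)
    (a * c' + c * a' + b * b' * G)"
proof -
  have "elt a b c * elt a' b' c' =
    to_ac (a * a') + to_ac (b * c' + c * b') * (\<alpha> * \<beta>) + to_ac (a * b' + b * a') * \<alpha>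
    + to_ac (c * c') * (\<beta> * \<beta>) + to_ac (a * c' + c * a') * \<beta> + to_ac (b * b') * (\<alpha> * \<alpha>)"
    by (simp add: elt_def algebra_simps)
  also have "\<dots> = elt (a * a' + (b * c' + c * b') * G * H) (a * b' + b * a' + c * c' * H)
    (a * c' + c * a' + b * b' * G)"
    unfolding alpha_alpha alpha_beta beta_beta by (simp add: elt_def algebra_simps)
  finally show ?thesis .
qed

lemma to_ac_eq_elt: "to_ac a = elt a 0 0"
  by (simp add: elt_def)

text \<open>
  The norm of \<open>a + b \<alpha> + c \<beta>\<close> over \<open>F(t)\<close>; \<open>elt_mult_adjugate\<close> exhibits the product of the other two
  conjugates, which gives explicit inverses.
\<close>

definition nrm :: "'a poly fract \<Rightarrow> 'a poly fract \<Rightarrow> 'a poly fract \<Rightarrow> 'a poly fract" where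
  "nrm a b c = a ^ 3 + b ^ 3 * G\<^sup>2 * H + c ^ 3 * G * H\<^sup>2 - 3 * a * b * c * G * H"

lemma elt_mult_adjugate:
  "elt a b c * elt (a\<^sup>2 - b * c * G * H) (c\<^sup>2 * H - a * b) (b\<^sup>2 * G - a * c) = to_ac (nrm a b c)"
  unfolding elt_mult to_ac_eq_elt nrm_def
  by (rule arg_cong3[of _ _ _ _ _ _ elt])
    (simp_all add: algebra_simps power2_eq_square power3_eq_cube)

lemma nrm_eq_0_imp:
  assumes "nrm a b c = 0"
  shows "a = 0 \<and> b = 0 \<and> c = 0"
proof -
  obtain P where P: "prime_elem P" "P dvd g"
    using degree_g by (rule exists_prime_elem_dvd_poly)
  have Ph: "\<not> P dvd h"
    using P coprime_g_h by (auto simp: coprime_def prime_elem_def)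
  obtain a' b' c' d where d: "d \<noteq> 0" "a = to_fract a' / to_fract d"
    "b = to_fract b' / to_fract d" "c = to_fract c' / to_fract d"
    by (rule common_denominator_fract)
  have "to_fract (a' ^ 3 + b' ^ 3 * g\<^sup>2 * h + c' ^ 3 * g * h\<^sup>2 - 3 * a' * b' * c' * g * h)
    = to_fract d ^ 3 * nrm a b c"
    unfolding nrm_def d using d(1) by (simp add: field_simps to_fract_power power3_eq_cube)
  also have "\<dots> = 0" using assms by simp
  finally have "a' ^ 3 + b' ^ 3 * g\<^sup>2 * h + c' ^ 3 * g * h\<^sup>2 = 3 * a' * b' * c' * g * h"
    by (simp only: to_fract_eq_0_iff) simp
  then have "a' = 0 \<and> b' = 0 \<and> c' = 0"
    by (rule norm_form_eq_0_imp[OF P squarefree_not_prime_square_dvd[OF squarefree_g P(1)] Ph])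
  then show ?thesis using d by simp
qed

lemma elt_eq_0_iff: "elt a b c = 0 \<longleftrightarrow> a = 0 \<and> b = 0 \<and> c = 0"
proof
  assume "elt a b c = 0"
  with elt_mult_adjugate[of a b c] have "nrm a b c = 0" by simp
  then show "a = 0 \<and> b = 0 \<and> c = 0" by (rule nrm_eq_0_imp)
qed (simp add: elt_def)

lemma elt_eq_iff: "elt a b c = elt a' b' c' \<longleftrightarrow> a = a' \<and> b = b' \<and> c = c'"
proof -
  have "elt a b c = elt a' b' c' \<longleftrightarrow> elt (a - a') (b - b') (c - c') = 0"
    by (simp flip: elt_diff)
  then show ?thesis by (simp add: elt_eq_0_iff)
qed

definition elts :: "'a poly fract alg_closure set" where
  "elts = {elt a b c |a b c. True}"

lemma inverse_elt:
  assumes "elt a b c \<noteq> 0"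
  shows "inverse (elt a b c) \<in> elts"
proof -
  let ?n = "nrm a b c"
  have n: "?n \<noteq> 0" using assms nrm_eq_0_imp elt_eq_0_iff by blast
  have "inverse (elt a b c)
    = elt (a\<^sup>2 - b * c * G * H) (c\<^sup>2 * H - a * b) (b\<^sup>2 * G - a * c) * elt (inverse ?n) 0 0"
    using elt_mult_adjugate[of a b c] n assms
    by (simp add: field_simps flip: to_ac_eq_elt)
  also have "\<dots> \<in> elts"
    unfolding elt_mult elts_def by blast
  finally show ?thesis .
qed

lemma generate_field_eq: 
  "generate_field ring_of_type_algebra (insert \<alpha> (range to_ac)) = elts"
proof (intro equalityI subsetI)
  note defs = ring_of_type_algebra_def
  fix x assume "x \<in> generate_field ring_of_type_algebra (insert \<alpha> (range to_ac))"
  then show "x \<in> elts"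
  proof induction
    case one
    have "elt 1 0 0 \<in> elts" by (auto simp: elts_def)
    then show ?case by (simp add: elt_def defs)
  next
    case (incl x)
    have "elt 0 1 0 \<in> elts" "\<And>a. elt a 0 0 \<in> elts" by (auto simp: elts_def)
    then show ?case using incl by (auto simp: elt_def)
  next
    case (a_inv x)
    then show ?case unfolding ring_of_type_algebra_inverses elts_def
      using elt_uminus by blast
  next
    case (m_inv x)
    then have "x \<noteq> 0" by (simp add: defs)
    with m_inv inverse_elt show ?case
      by (auto simp: ring_of_type_algebra_inverses elts_def)
  next
    case (eng_add x y)
    then have "x + y \<in> elts" unfolding elts_def using elt_add by blast
    then show ?case by (simp add: defs)
  next
    case (eng_mult x y)
    then have "x * y \<in> elts" unfolding elts_def using elt_mult by blast
    then show ?case by (simp add: defs)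
  qed
next
  let ?K = "generate_field ring_of_type_algebra (insert \<alpha> (range to_ac))"
  have k: "to_ac a \<in> ?K" for a by (intro generate_field.incl) simp
  have al: "\<alpha> \<in> ?K" by (intro generate_field.incl) simp
  have add: "x + y \<in> ?K" if "x \<in> ?K" "y \<in> ?K" for x y
    using generate_field.eng_add[OF that] by (simp add: ring_of_type_algebra_def)
  have mult: "x * y \<in> ?K" if "x \<in> ?K" "y \<in> ?K" for x y
    using generate_field.eng_mult[OF that] by (simp add: ring_of_type_algebra_def)
  have "\<beta> = \<alpha> * \<alpha> * to_ac (inverse G)"
    by (simp add: \<beta>_def embed_poly_eq power2_eq_square field_simps)
  then have "\<beta> \<in> ?K" using k al mult by (simp only:)
  then have "elt a b c \<in> ?K" for a b c unfolding elt_def by (intro add mult k al)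
  moreover fix x assume "x \<in> elts"
  ultimately show "x \<in> ?K" by (auto simp: elts_def)
qed


definition charpoly :: "'a poly fract \<Rightarrow> 'a poly fract \<Rightarrow> 'a poly fract \<Rightarrow> 'a poly fract poly" where
  "charpoly a b c = [:- nrm a b c, 3 * (a\<^sup>2 - b * c * G * H), - 3 * a, 1:]"

lemma elt_charpoly:
  "elt a b c ^ 3 - to_ac (3 * a) * elt a b c ^ 2 + to_ac (3 * (a\<^sup>2 - b * c * G * H)) * elt a b c
    - to_ac (nrm a b c) = 0"
  unfolding to_ac_eq_elt power3_eq_cube power2_eq_square elt_mult elt_diff elt_add elt_eq_0_iff nrm_def
  by (simp add: algebra_simps power2_eq_square power3_eq_cube)

lemma poly_charpoly_elt: "poly (map_poly to_ac (charpoly a b c)) (elt a b c) = 0"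
  using elt_charpoly[of a b c]
  by (simp add: charpoly_def map_poly_pCons algebra_simps power2_eq_square power3_eq_cube)

lemma cube_relation_imp_0:
  assumes "b ^ 3 * G = c ^ 3 * H"
  shows "b = 0 \<and> c = 0"
proof -
  have "nrm 0 b (- c) * inverse (G * H) = b ^ 3 * G - c ^ 3 * H"
    using g_nz h_nz by (simp add: nrm_def field_simps power2_eq_square power3_eq_cube)
  with assms have "nrm 0 b (- c) * inverse (G * H) = 0" by simp
  then have "nrm 0 b (- c) = 0" using g_nz h_nz by simp
  from nrm_eq_0_imp[OF this] show ?thesis by simp
qed

text \<open>
  The characteristic polynomial is the minimal polynomial as soon as the element is not in \<open>F(t)\<close>:
  the powers \<open>1, u, u\<^sup>2\<close> have determinant \<open>b\<^sup>3 g - c\<^sup>3 h\<close>, which does not vanish because \<open>h / g\<close> is not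
  a cube. So the remainder of a division by it, which has degree at most \<open>2\<close>, is zero.
\<close>

lemma charpoly_dvd:
  assumes "poly (map_poly to_ac p) (elt a b c) = 0" "b \<noteq> 0 \<or> c \<noteq> 0"
  shows "charpoly a b c dvd p"
proof -
  let ?x = "charpoly a b c"
  have x0: "?x \<noteq> 0" by (simp add: charpoly_def)
  define q r where "q = p div ?x" and "r = p mod ?x"
  have p: "p = ?x * q + r" unfolding q_def r_def by simp
  have "map_poly to_ac (?x * q + r) = map_poly to_ac ?x * map_poly to_ac q + map_poly to_ac r"
    by (subst map_poly_hom_add) (simp_all add: map_poly_hom_mult)
  with assms(1)[unfolded p] poly_charpoly_elt[of a b c]
  have r: "poly (map_poly to_ac r) (elt a b c) = 0" by simp
  have "degree ?x = 3" by (simp add: charpoly_def)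
  then have "r = 0 \<or> degree r < 3" using degree_mod_less[OF x0, of p] r_def by simp
  then have "degree r \<le> 2" by auto
  then have "r = [:coeff r 0, coeff r 1, coeff r 2:]"
    by (intro poly_eqI) (auto simp: coeff_pCons coeff_eq_0 numeral_2_eq_2 split: nat.splits)
  then obtain r0 r1 r2 where req: "r = [:r0, r1, r2:]" by blast
  have "to_ac r0 + to_ac r1 * elt a b c + to_ac r2 * (elt a b c * elt a b c) = 0"
    using r unfolding req by (simp add: map_poly_pCons algebra_simps)
  then have eqs: "r0 + r1 * a + r2 * (a * a + 2 * b * c * G * H) = 0"
    "r1 * b + r2 * (2 * a * b + c * c * H) = 0"
    "r1 * c + r2 * (2 * a * c + b * b * G) = 0"
    unfolding to_ac_eq_elt elt_mult elt_add elt_eq_0_iff by (simp_all add: algebra_simps)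
  have "r2 * (b ^ 3 * G - c ^ 3 * H) = b * (r1 * c + r2 * (2 * a * c + b * b * G))
      - c * (r1 * b + r2 * (2 * a * b + c * c * H))"
    by (simp add: algebra_simps power3_eq_cube)
  also have "\<dots> = 0" unfolding eqs by simp
  finally have r2: "r2 = 0" using cube_relation_imp_0[of b c] assms(2) by auto
  with eqs assms(2) have r1: "r1 = 0" by auto
  with r2 eqs have "r0 = 0" by auto
  with r1 r2 req have "r = 0" by simp
  then show ?thesis unfolding r_def by (simp add: dvd_eq_mod_eq_0)
qed

text \<open>
  The \<open>F[t]\<close>-module spanned by \<open>1\<close>, \<open>\<alpha>\<close>, \<open>\<beta>\<close>, which turns out to be the integral closure.
\<close>

definition poly_elts :: "'a poly fract alg_closure set" where
  "poly_elts = {elt (to_fract a) (to_fract b) (to_fract c) |a b c. True}"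

lemma fract_of_three_mult:
  assumes "3 * x = to_fract y"
  shows "\<exists>z :: 'a poly. x = to_fract z"
proof -
  have 3: "(3 :: 'a) \<noteq> 0" using three_neq_0[OF char_neq_3] .
  define z where "z = smult (inverse 3) y"
  have "y = 3 * z"
  proof (rule poly_eqI)
    fix n
    have "3 * z = z + z + z" by simp
    then have "coeff (3 * z) n = coeff z n + coeff z n + coeff z n" by (simp only: coeff_add)
    also have "\<dots> = 3 * coeff z n" by simp
    also have "coeff z n = inverse 3 * coeff y n" unfolding z_def by (rule coeff_smult)
    also have "3 * (inverse 3 * coeff y n) = coeff y n" using 3 by simp
    finally show "coeff y n = coeff (3 * z) n" ..
  qed
  with assms have "x * 3 = to_fract z * 3" by simp
  moreover have "(3 :: 'a poly fract) \<noteq> 0"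
  proof -
    have "(3 :: 'a poly) = [:3:]" by (simp add: numeral_poly)
    then have "(3 :: 'a poly) \<noteq> 0" using 3 by (metis pCons_eq_0_iff)
    then show ?thesis by (metis to_fract_numeral to_fract_eq_0_iff)
  qed
  ultimately show ?thesis by simp
qed

lemma cubefree_gh:
  assumes "prime_elem P"
  shows "\<not> P ^ 3 dvd g\<^sup>2 * h" "\<not> P ^ 3 dvd g * h\<^sup>2"
proof -
  have or: "\<not> P dvd g \<or> \<not> P dvd h"
    using assms coprime_g_h by (auto simp: coprime_def prime_elem_def)
  have *: "\<not> P ^ 3 dvd g ^ i * h ^ j" if "i \<le> 2" "j \<le> 2" for i j
  proof
    assume d: "P ^ 3 dvd g ^ i * h ^ j"
    show False
      using or
    proof
      assume "\<not> P dvd g"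
      then have "\<not> P dvd g ^ i" using assms prime_elem_dvd_power by blast
      from prime_elem_power_dvd_mult_cancel[OF assms this d]
      show False using squarefree_power_cubefree[OF squarefree_h that(2) assms] by blast
    next
      assume "\<not> P dvd h"
      then have "\<not> P dvd h ^ j" using assms prime_elem_dvd_power by blast
      from prime_elem_power_dvd_mult_cancel[OF assms this d[unfolded mult.commute[of "g ^ i"]]]
      show False using squarefree_power_cubefree[OF squarefree_g that(1) assms] by blast
    qed
  qed
  from *[of 2 1] *[of 1 2] show "\<not> P ^ 3 dvd g\<^sup>2 * h" "\<not> P ^ 3 dvd g * h\<^sup>2" by simp_all
qed

text \<open>
  Unless \<open>b = c = 0\<close>, the characteristic polynomial has coefficients in \<open>F[t]\<close> by Gauss's lemma. Its trace gives
  \<open>a\<close>, because \<open>3\<close> is invertible. The other coefficients then provide the sum and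
  the product of \<open>b\<^sup>3 g\<^sup>2 h\<close> and \<open>c\<^sup>3 g h\<^sup>2\<close>, which are therefore roots of a monic quadratic polynomial and lie in
  \<open>F[t]\<close>. As \<open>g\<^sup>2 h\<close> and \<open>g h\<^sup>2\<close> are cube-free, \<open>b\<close> and \<open>c\<close> have no denominators.
\<close>

lemma integral_imp_poly_elt:
  assumes "integral_over_poly (elt a b c)"
  shows "\<exists>a' b' c'. a = to_fract a' \<and> b = to_fract b' \<and> c = to_fract c'"
proof -
  obtain P :: "'a poly poly" where P: "lead_coeff P = 1" "poly (map_poly embed_poly P) (elt a b c) = 0"
    using assms unfolding integral_over_poly_def by blast
  have "map_poly embed_poly P = map_poly to_ac (map_poly to_fract P)"
    by (simp add: map_poly_map_poly o_def embed_poly_eq[abs_def])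
  with P have root: "poly (map_poly to_ac (map_poly to_fract P)) (elt a b c) = 0" by simp
  show ?thesis
  proof (cases "b \<noteq> 0 \<or> c \<noteq> 0")
    case False
    have ev: "to_ac (poly Q a) = poly (map_poly to_ac Q) (to_ac a)" for Q
      by (induction Q) (simp_all add: map_poly_pCons)
    have "to_ac (poly (map_poly to_fract P) a) = 0"
      unfolding ev using root False by (simp add: elt_def)
    then have "poly (map_poly to_fract P) a = 0" by (simp only: to_ac_eq_0_iff)
    from integral_fract_is_poly[OF P(1) this] obtain a' where "a = to_fract a'" ..
    with False show ?thesis by (metis to_fract_0)
  next
    case True
    have "lead_coeff (charpoly a b c) = 1" by (simp add: charpoly_def)
    from monic_factor_of_monic_integral[OF P(1) this charpoly_dvd[OF root True]]
    obtain q where q: "charpoly a b c = map_poly to_fract q" ..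
    have co: "coeff (charpoly a b c) n = to_fract (coeff q n)" for n
      unfolding q by (simp add: coeff_map_poly)
    have "3 * a = to_fract (- coeff q 2)"
      by (simp add: charpoly_def numeral_2_eq_2 flip: co)
    from fract_of_three_mult[OF this] obtain a' where a': "a = to_fract a'" ..
    have "3 * (a\<^sup>2 - b * c * G * H) = to_fract (coeff q 1)"
      using co[of 1] by (simp add: charpoly_def)
    from fract_of_three_mult[OF this] obtain s where s: "a\<^sup>2 - b * c * G * H = to_fract s" ..
    \<comment> \<open>\<open>w = b c g h\<close>, so \<open>w\<^sup>3\<close> is the product and \<open>v\<close> below the sum of the two terms of the norm in question.\<close>
    define w where "w = a' ^ 2 - s"
    have w: "b * c * G * H = to_fract w"
      using s by (simp add: w_def a' to_fract_power algebra_simps)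
    define v where "v = - coeff q 0 - a' ^ 3 + 3 * a' * w"
    have n: "nrm a b c = to_fract (- coeff q 0)"
      by (simp add: charpoly_def flip: co)
    have "nrm a b c = a ^ 3 + b ^ 3 * G\<^sup>2 * H + c ^ 3 * G * H\<^sup>2 - 3 * a * (b * c * G * H)"
      by (simp add: nrm_def algebra_simps)
    then have v: "b ^ 3 * (G\<^sup>2 * H) + c ^ 3 * (G * H\<^sup>2) = to_fract v"
      unfolding n w v_def by (simp add: a' to_fract_power algebra_simps)
    have wp: "(b ^ 3 * (G\<^sup>2 * H)) * (c ^ 3 * (G * H\<^sup>2)) = to_fract (w ^ 3)"
      unfolding to_fract_power w[symmetric] by (simp add: algebra_simps power2_eq_square power3_eq_cube)
    have quad: "\<exists>z. x = to_fract z" if "x + y = to_fract v" "x * y = to_fract (w ^ 3)" for x y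
    proof (rule integral_fract_is_poly)
      show "lead_coeff [:w ^ 3, - v, 1:] = 1" by simp
      have "poly (map_poly to_fract [:w ^ 3, - v, 1:]) x = to_fract (w ^ 3) - x * to_fract v + x * x"
        by (simp add: map_poly_pCons algebra_simps)
      then show "poly (map_poly to_fract [:w ^ 3, - v, 1:]) x = 0"
        unfolding that[symmetric] by (simp add: algebra_simps)
    qed
    obtain y1 where "b ^ 3 * to_fract (g\<^sup>2 * h) = to_fract y1"
      using quad[OF v wp] by (auto simp: to_fract_power)
    from fract_of_cube_mult_cubefree[OF cubefree_gh(1) this] obtain b' where b': "b = to_fract b'" by blast
    obtain y2 where "c ^ 3 * to_fract (g * h\<^sup>2) = to_fract y2"
      using quad[of "c ^ 3 * (G * H\<^sup>2)" "b ^ 3 * (G\<^sup>2 * H)"] v wp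
      by (auto simp: to_fract_power add.commute mult.commute)
    from fract_of_cube_mult_cubefree[OF cubefree_gh(2) this] obtain c' where "c = to_fract c'" by blast
    with a' b' show ?thesis by blast
  qed
qed

lemma poly_elt_integral: "integral_over_poly (elt (to_fract a) (to_fract b) (to_fract c))"
proof -
  define N where "N = a ^ 3 + b ^ 3 * g\<^sup>2 * h + c ^ 3 * g * h\<^sup>2 - 3 * a * b * c * g * h"
  define P where "P = [:- N, 3 * (a\<^sup>2 - b * c * g * h), - 3 * a, 1:]"
  have "charpoly (to_fract a) (to_fract b) (to_fract c) = map_poly to_fract P"
    by (simp add: charpoly_def P_def N_def nrm_def map_poly_pCons to_fract_power)
  moreover have "map_poly embed_poly P = map_poly to_ac (map_poly to_fract P)"
    by (simp add: map_poly_map_poly o_def embed_poly_eq[abs_def])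
  ultimately have "poly (map_poly embed_poly P) (elt (to_fract a) (to_fract b) (to_fract c)) = 0"
    using poly_charpoly_elt[of "to_fract a" "to_fract b" "to_fract c"] by simp
  moreover have "lead_coeff P = 1" by (simp add: P_def)
  ultimately show ?thesis unfolding integral_over_poly_def by blast
qed

lemma integral_closure_eq: "integral_closure_in elts = poly_elts"
  unfolding integral_closure_in_def elts_def poly_elts_def
  using integral_imp_poly_elt poly_elt_integral by blast

abbreviation pelt :: "'a poly \<Rightarrow> 'a poly \<Rightarrow> 'a poly \<Rightarrow> 'a poly fract alg_closure" where
  "pelt a b c \<equiv> elt (to_fract a) (to_fract b) (to_fract c)"

lemma pelt_eq_iff: "pelt a b c = pelt a' b' c' \<longleftrightarrow> a = a' \<and> b = b' \<and> c = c'"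
  by (simp add: elt_eq_iff)

lemma pelt_add: "pelt a b c + pelt a' b' c' = pelt (a + a') (b + b') (c + c')"
  by (simp add: elt_add)

lemma pelt_mult: "pelt a b c * pelt a' b' c' =
  pelt (a * a' + (b * c' + c * b') * g * h) (a * b' + b * a' + c * c' * h) (a * c' + c * a' + b * b' * g)"
  by (simp add: elt_mult)

lemma embed_poly_eq_pelt: "embed_poly p = pelt p 0 0"
  by (simp add: embed_poly_eq elt_def)

lemma poly_ring_adjoin_pelt_subset: "poly_ring_adjoin (pelt a b c) \<subseteq> poly_elts"
proof -
  have "poly (map_poly embed_poly P) (pelt a b c) \<in> poly_elts" for P
  proof (induction P)
    case 0
    show ?case unfolding poly_elts_def by (auto simp: elt_eq_0_iff intro!: exI[of _ 0])
  next
    case (pCons s P)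
    then obtain a' b' c' where "poly (map_poly embed_poly P) (pelt a b c) = pelt a' b' c'"
      unfolding poly_elts_def by blast
    then have "poly (map_poly embed_poly (pCons s P)) (pelt a b c)
      = pelt s 0 0 + pelt a b c * pelt a' b' c'"
      by (simp only: map_poly_embed_pCons poly_pCons embed_poly_eq_pelt)
    then show ?case unfolding pelt_mult pelt_add poly_elts_def by blast
  qed
  then show ?thesis unfolding poly_ring_adjoin_def by blast
qed

text \<open>
  Every polynomial in \<open>\<theta> = a + \<eta>\<close> with \<open>\<eta> = x \<alpha> + y \<beta>\<close> is of the form \<open>p + q \<eta> + r \<eta>\<^sup>2\<close>, since
  \<open>\<eta>\<^sup>3 = (x\<^sup>3 g\<^sup>2 h + y\<^sup>3 g h\<^sup>2) + 3 x y g h \<eta>\<close>; the right-hand side displays the coordinates of this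
  expression, as \<open>\<eta>\<^sup>2 = 2 x y g h + y\<^sup>2 h \<alpha> + x\<^sup>2 g \<beta>\<close>.
\<close>

lemma poly_eval_pelt:
  "\<exists>p q r. poly (map_poly embed_poly P) (pelt a x y)
    = pelt (p + 2 * x * y * g * h * r) (q * x + r * y\<^sup>2 * h) (q * y + r * x\<^sup>2 * g)"
proof (induction P)
  case 0
  show ?case by (auto simp: elt_eq_0_iff intro!: exI[of _ 0])
next
  case (pCons s P)
  then obtain p q r where IH: "poly (map_poly embed_poly P) (pelt a x y)
    = pelt (p + 2 * x * y * g * h * r) (q * x + r * y\<^sup>2 * h) (q * y + r * x\<^sup>2 * g)" by blast
  define r' where "r' = q + a * r"
  define q' where "q' = p + a * q + 3 * x * y * g * h * r"
  define p' where "p' = s + a * p + (x ^ 3 * g\<^sup>2 * h + y ^ 3 * g * h\<^sup>2) * r"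
  have "poly (map_poly embed_poly (pCons s P)) (pelt a x y) = pelt s 0 0 + pelt a x y *
    pelt (p + 2 * x * y * g * h * r) (q * x + r * y\<^sup>2 * h) (q * y + r * x\<^sup>2 * g)"
    by (simp only: map_poly_embed_pCons poly_pCons embed_poly_eq_pelt IH)
  also have "\<dots> = pelt (p' + 2 * x * y * g * h * r') (q' * x + r' * y\<^sup>2 * h) (q' * y + r' * x\<^sup>2 * g)"
    unfolding pelt_mult pelt_add pelt_eq_iff p'_def q'_def r'_def
    by (simp add: algebra_simps power2_eq_square power3_eq_cube)
  finally show ?case by blast
qed

text \<open>
  The polynomial \<open>g x\<^sup>3 - h y\<^sup>3\<close> is the determinant that expresses \<open>1, \<theta>, \<theta>\<^sup>2\<close> in terms of
  \<open>1, \<alpha>, \<beta>\<close>. If \<open>\<theta>\<close> generates, then \<open>\<alpha>\<close> and \<open>\<beta>\<close> are polynomials in \<open>\<theta>\<close>, and multiplicativity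
  of determinants exhibits an inverse; conversely Cramer's rule solves for the coefficients.
\<close>

lemma poly_elts_eq_adjoin_iff:
  "poly_elts = poly_ring_adjoin (pelt a x y) \<longleftrightarrow> is_unit (g * x ^ 3 - h * y ^ 3)"
proof
  assume eq: "poly_elts = poly_ring_adjoin (pelt a x y)"
  have "pelt 0 1 0 \<in> poly_ring_adjoin (pelt a x y)" "pelt 0 0 1 \<in> poly_ring_adjoin (pelt a x y)"
    unfolding eq[symmetric] poly_elts_def by blast+
  then obtain P Q where "pelt 0 1 0 = poly (map_poly embed_poly P) (pelt a x y)"
    "pelt 0 0 1 = poly (map_poly embed_poly Q) (pelt a x y)"
    unfolding poly_ring_adjoin_def by blast
  then obtain q r q' r' where "1 = q * x + r * y\<^sup>2 * h" "0 = q * y + r * x\<^sup>2 * g"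
    "0 = q' * x + r' * y\<^sup>2 * h" "1 = q' * y + r' * x\<^sup>2 * g"
    using poly_eval_pelt[of P a x y] poly_eval_pelt[of Q a x y] pelt_eq_iff by metis
  then have "1 * 1 - 0 * 0 = (q * x + r * y\<^sup>2 * h) * (q' * y + r' * x\<^sup>2 * g)
      - (q * y + r * x\<^sup>2 * g) * (q' * x + r' * y\<^sup>2 * h)" by (simp only:)
  also have "\<dots> = (g * x ^ 3 - h * y ^ 3) * (q * r' - r * q')"
    by (simp add: algebra_simps power2_eq_square power3_eq_cube)
  finally show "is_unit (g * x ^ 3 - h * y ^ 3)" by (metis diff_zero dvd_triv_left mult_1 mult_zero_left)
next
  assume "is_unit (g * x ^ 3 - h * y ^ 3)"
  then obtain d where d: "1 = (g * x ^ 3 - h * y ^ 3) * d" by blast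
  have "pelt b c e \<in> poly_ring_adjoin (pelt a x y)" for b c e
  proof -
    \<comment> \<open>Cramer's rule for \<open>q x + r y\<^sup>2 h = c\<close> and \<open>q y + r x\<^sup>2 g = e\<close>, where \<open>d\<close> is the inverse determinant\<close>
    define q where "q = d * (c * x\<^sup>2 * g - e * y\<^sup>2 * h)"
    define r where "r = d * (e * x - c * y)"
    define p where "p = b - 2 * x * y * g * h * r"
    have c: "q * x + r * y\<^sup>2 * h = c"
    proof -
      have "q * x + r * y\<^sup>2 * h = c * ((g * x ^ 3 - h * y ^ 3) * d)"
        by (simp add: q_def r_def algebra_simps power2_eq_square power3_eq_cube)
      then show ?thesis by (simp flip: d)
    qed
    have e: "q * y + r * x\<^sup>2 * g = e"
    proof -
      have "q * y + r * x\<^sup>2 * g = e * ((g * x ^ 3 - h * y ^ 3) * d)"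
        by (simp add: q_def r_def algebra_simps power2_eq_square power3_eq_cube)
      then show ?thesis by (simp flip: d)
    qed
    have *: "poly (map_poly embed_poly [:p - a * q + a\<^sup>2 * r, q - 2 * a * r, r:]) (pelt a x y)
      = pelt (p - a * q + a\<^sup>2 * r) 0 0 + pelt a x y * (pelt (q - 2 * a * r) 0 0 + pelt a x y * pelt r 0 0)"
      by (simp only: map_poly_embed_pCons poly_pCons embed_poly_eq_pelt) (simp add: elt_def)
    also have "\<dots> = pelt (p + 2 * x * y * g * h * r) (q * x + r * y\<^sup>2 * h) (q * y + r * x\<^sup>2 * g)"
      unfolding pelt_mult pelt_add pelt_eq_iff
      by (simp add: algebra_simps power2_eq_square power3_eq_cube)
    also have "\<dots> = pelt b c e" unfolding c e by (simp add: p_def)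
    finally show ?thesis unfolding poly_ring_adjoin_def by (metis rangeI)
  qed
  then show "poly_elts = poly_ring_adjoin (pelt a x y)"
    using poly_ring_adjoin_pelt_subset unfolding poly_elts_def by blast
qed

lemma monogenic_elts_iff: "monogenic elts \<longleftrightarrow> (\<exists>x y. is_unit (g * x ^ 3 - h * y ^ 3))"
proof -
  have "monogenic elts \<longleftrightarrow> (\<exists>a x y. poly_elts = poly_ring_adjoin (pelt a x y))"
  proof -
    have mem: "t \<in> poly_elts \<longleftrightarrow> (\<exists>a x y. t = pelt a x y)" for t
      by (simp add: poly_elts_def)
    show ?thesis unfolding monogenic_def integral_closure_eq Bex_def mem by blast
  qed
  then show ?thesis unfolding poly_elts_eq_adjoin_iff by blast
qed

end

lemma cbrt_cube: "cbrt f ^ 3 = embed_poly f"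
  unfolding cbrt_def by (rule someI_ex) (simp add: nth_root_exists)

theorem monogenic_cubic_field_iff:
  fixes g h :: "'a::field poly"
  assumes "CHAR('a) \<noteq> 3" "degree g > 0" "squarefree g" "squarefree h" "coprime g h"
  shows "monogenic (cubic_field (g\<^sup>2 * h)) \<longleftrightarrow> (\<exists>x y. is_unit (g * x ^ 3 - h * y ^ 3))"
proof -
  interpret pure_cubic g h "cbrt (g\<^sup>2 * h)"
    using assms cbrt_cube[of "g\<^sup>2 * h"] by unfold_locales
  show ?thesis unfolding cubic_field_def generate_field_eq by (rule monogenic_elts_iff)
qed

lemma monogenic_set_eq:
  fixes g :: "'a::field poly"
  assumes "CHAR('a) \<noteq> 3" "degree g > 0" "squarefree g"
  shows "monogenic_set g =
    {h. squarefree h \<and> coprime g h \<and> (\<exists>x y. is_unit (g * x ^ 3 - h * y ^ 3))}"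
  unfolding monogenic_set_def using monogenic_cubic_field_iff[OF assms] by blast

section \<open>Degree bounds for the Thue equation\<close>

lemma frobenius_surj:
  fixes x :: "'a::{field,finite}"
  shows "\<exists>y. y ^ CHAR('a) = x"
proof -
  have "inj (\<lambda>y :: 'a. y ^ CHAR('a))"
  proof (rule injI)
    fix y z :: 'a
    assume *: "y ^ CHAR('a) = z ^ CHAR('a)"
    have "y ^ CHAR('a) = (y - z) ^ CHAR('a) + z ^ CHAR('a)"
      using freshmans_dream[OF prime_CHAR_finite refl, of "y - z" z] by simp
    with * have "(y - z) ^ CHAR('a) = 0" by simp
    then show "y = z" by simp
  qed
  then have "surj (\<lambda>y :: 'a. y ^ CHAR('a))" by (simp add: finite_UNIV_inj_surj)
  then show ?thesis by (metis surjD)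
qed

lemma freshmans_dream_poly:
  fixes a b :: "'a::{field,finite} poly"
  shows "(a + b) ^ CHAR('a) = a ^ CHAR('a) + b ^ CHAR('a)"
  by (rule freshmans_dream) (simp_all add: prime_CHAR_finite)

text \<open>
  Over a perfect field only exponents divisible by \<open>p\<close> survive in \<open>q\<close>, and their coefficients have
  \<open>p\<close>-th roots; the induction removes the leading term.
\<close>

lemma pderiv_eq_0_imp_pth_power:
  fixes q :: "'a::{field,finite} poly"
  assumes "pderiv q = 0"
  shows "\<exists>r. q = r ^ CHAR('a)"
  using assms
proof (induction "degree q" arbitrary: q rule: less_induct)
  case less
  let ?p = "CHAR('a)"
  have p: "prime ?p" by (rule prime_CHAR_finite)
  obtain c where c: "c ^ ?p = lead_coeff q" using frobenius_surj by blast
  show ?case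
  proof (cases "degree q = 0")
    case True
    then obtain a where a: "q = [:a:]" by (rule degree_eq_zeroE)
    then have "q = [:c:] ^ ?p" using c by (simp add: poly_const_pow)
    then show ?thesis ..
  next
    case False
    then obtain n where n: "degree q = Suc n" by (cases "degree q") auto
    have "coeff (pderiv q) n = of_nat (Suc n) * lead_coeff q" by (simp add: coeff_pderiv n)
    moreover have "lead_coeff q \<noteq> 0" using False by auto
    ultimately have "of_nat (Suc n) = (0 :: 'a)" using less.prems by simp
    then have "?p dvd degree q" unfolding n by (simp only: of_nat_eq_0_iff_char_dvd)
    then obtain k where k: "degree q = ?p * k" by blast
    define s where "s = monom c k"
    have s: "s ^ ?p = monom (lead_coeff q) (degree q)"
      by (simp add: s_def monom_power c k mult.commute)
    have s': "pderiv (s ^ ?p) = 0" by (simp add: pderiv_power)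
    have "degree (q - s ^ ?p) < degree q"
    proof (rule degree_lessI)
      show "q - s ^ ?p \<noteq> 0 \<or> 0 < degree q" using False by simp
      show "\<forall>i\<ge>degree q. coeff (q - s ^ ?p) i = 0"
        unfolding s by (auto simp: coeff_eq_0)
    qed
    moreover have "pderiv (q - s ^ ?p) = 0" using less.prems s' by (simp add: pderiv_diff)
    ultimately obtain r where "q - s ^ ?p = r ^ ?p" using less.hyps by blast
    then have "q = (r + s) ^ ?p" by (simp add: freshmans_dream_poly algebra_simps)
    then show ?thesis ..
  qed
qed

text \<open>
  Raise the equation to the power \<open>p\<close>: as \<open>p\<^sup>2\<close> is \<open>1\<close> modulo \<open>3\<close>, the left-hand side becomes \<open>A\<close> times a cube.
  That cube divides a power of \<open>g\<close> with exponent at most \<open>2\<close> times a cube, hence can be cancelled.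
\<close>

lemma root_of_power_mult_cube:
  fixes A g x :: "'a::field poly"
  assumes "squarefree g" "\<not> 3 dvd p" "A ^ p = g ^ e * x ^ 3" "A \<noteq> 0"
  shows "\<exists>x'. A = g ^ (e * p mod 3) * x' ^ 3"
proof -
  obtain s where pp: "p * p = s * 3 + 1" using assms(2) by (rule square_eq_1_mod_3)
  define r k where "r = e * p mod 3" and "k = e * p div 3"
  have ep: "e * p = k * 3 + r" unfolding r_def k_def by simp
  have "A * (A ^ s) ^ 3 = A ^ (p * p)" unfolding pp by (simp add: power_add power_mult)
  also have "\<dots> = (g ^ e * x ^ 3) ^ p" by (simp add: power_mult assms(3))
  also have "\<dots> = g ^ (e * p) * (x ^ 3) ^ p" by (simp add: power_mult_distrib power_mult)
  also have "\<dots> = g ^ r * (g ^ k * x ^ p) ^ 3"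
    unfolding ep by (simp add: power_add power_mult power_mult_distrib mult_ac flip: power_mult)
  finally have eq: "A * (A ^ s) ^ 3 = g ^ r * (g ^ k * x ^ p) ^ 3" .
  then have "(A ^ s) ^ 3 dvd g ^ r * (g ^ k * x ^ p) ^ 3" by (metis dvd_triv_right)
  moreover have "r \<le> 2" unfolding r_def by simp
  ultimately have "A ^ s dvd g ^ k * x ^ p"
    using dvd_of_cube_dvd_cubefree_mult_cube[of "g ^ r" "A ^ s"] squarefree_power_cubefree[OF assms(1)]
      assms(4) by simp
  then obtain x' where "g ^ k * x ^ p = A ^ s * x'" by blast
  with eq have "(A ^ s) ^ 3 * A = (A ^ s) ^ 3 * (g ^ r * x' ^ 3)"
    by (simp add: power_mult_distrib mult_ac)
  then have "A = g ^ r * x' ^ 3" using assms(4) by simp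
  then show ?thesis unfolding r_def ..
qed

text \<open>
  Inseparable solutions are \<open>p\<close>-th powers up to the constant, which is itself a \<open>p\<close>-th power.
  Taking roots lowers the degree, at the price of exchanging the exponents \<open>1\<close> and \<open>2\<close> when
  \<open>p\<close> is \<open>2\<close> modulo \<open>3\<close>; this is why the statement allows both.
\<close>

lemma exists_separable_solution:
  fixes g h :: "'a::{field,finite} poly"
  assumes "CHAR('a) \<noteq> 3" "squarefree g" "squarefree h" "degree g > 0" "degree h > 0"
    and "e \<in> {1, 2}" "c \<noteq> 0" "g ^ e * x ^ 3 - h ^ e * y ^ 3 = [:c:]"
  shows "\<exists>e\<in>{1, 2}. \<exists>x y c. c \<noteq> 0 \<and> g ^ e * x ^ 3 - h ^ e * y ^ 3 = [:c:] \<and> pderiv (g ^ e * x ^ 3) \<noteq> 0"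
  using assms(6-8)
proof (induction "degree (g ^ e * x ^ 3)" arbitrary: e x y c rule: less_induct)
  case less
  let ?p = "CHAR('a)"
  have p: "prime ?p" by (rule prime_CHAR_finite)
  have g0: "g \<noteq> 0" and h0: "h \<noteq> 0" using assms by auto
  have nonconst: "u = 0 \<or> degree (f ^ e * u ^ 3) > 0" if "degree f > 0" for f u :: "'a poly"
    using that less.prems(1) by (cases "u = 0"; cases "f = 0") (auto simp: degree_mult_eq degree_power_eq)
  show ?case
  proof (cases "pderiv (g ^ e * x ^ 3) = 0")
    case False
    then show ?thesis using less.prems by blast
  next
    case True
    then obtain A where A: "g ^ e * x ^ 3 = A ^ ?p" using pderiv_eq_0_imp_pth_power by blast
    obtain d where d: "d ^ ?p = c" using frobenius_surj by blast
    have d0: "d \<noteq> 0" using d less.prems(2) p by (auto simp: power_0_left prime_gt_0_nat)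
    define B where "B = A - [:d:]"
    have "A ^ ?p = B ^ ?p + [:d:] ^ ?p"
      using freshmans_dream_poly[of B "[:d:]"] by (simp add: B_def)
    then have B: "h ^ e * y ^ 3 = B ^ ?p"
      using less.prems(3) A d by (simp add: poly_const_pow algebra_simps)
    have A0: "A \<noteq> 0"
    proof
      assume "A = 0"
      then have "g ^ e * x ^ 3 = 0" using A p by (simp add: power_0_left prime_gt_0_nat)
      then have "h ^ e * y ^ 3 = - (g ^ e * x ^ 3 - h ^ e * y ^ 3)" by simp
      with less.prems(3) have *: "h ^ e * y ^ 3 = - [:c:]" by (simp only:)
      then have "degree (h ^ e * y ^ 3) = 0" by simp
      with nonconst[OF assms(5), of y] have "y = 0" by simp
      with * less.prems(2) show False by simp
    qed
    have B0: "B \<noteq> 0"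
    proof
      assume "B = 0"
      then have "h ^ e * y ^ 3 = 0" using B p by (simp add: power_0_left prime_gt_0_nat)
      with less.prems(3) have *: "g ^ e * x ^ 3 = [:c:]" by simp
      then have "degree (g ^ e * x ^ 3) = 0" by simp
      with nonconst[OF assms(4), of x] have "x = 0" by simp
      with * less.prems(2) show False by simp
    qed
    have p3: "\<not> 3 dvd ?p" using assms(1) by (rule not_3_dvd_CHAR)
    define e' where "e' = e * ?p mod 3"
    obtain x' where x': "A = g ^ e' * x' ^ 3"
      using root_of_power_mult_cube[OF assms(2) p3 A[symmetric] A0] e'_def by blast
    obtain y' where y': "B = h ^ e' * y' ^ 3"
      using root_of_power_mult_cube[OF assms(3) p3 B[symmetric] B0] e'_def by blast
    have "prime (3 :: nat)" by simp
    then have "\<not> 3 dvd e * ?p" using p3 less.prems(1) by (auto simp: prime_dvd_mult_iff)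
    then have "e' \<noteq> 0" unfolding e'_def by (simp add: dvd_eq_mod_eq_0)
    moreover have "e' < 3" unfolding e'_def by simp
    ultimately have e': "e' \<in> {1, 2}" by auto
    have eq: "g ^ e' * x' ^ 3 - h ^ e' * y' ^ 3 = [:d:]"
      unfolding x'[symmetric] y'[symmetric] by (simp add: B_def)
    have "x \<noteq> 0" using A A0 by auto
    with nonconst[OF assms(4), of x] have "degree (g ^ e * x ^ 3) > 0" by simp
    then have "degree A * ?p > 0" unfolding A using A0 by (simp add: degree_power_eq)
    then have "degree A < degree A * ?p" using prime_gt_1_nat[OF p] by simp
    then have "degree A < degree (g ^ e * x ^ 3)" unfolding A using A0
      by (simp add: degree_power_eq mult.commute)
    then show ?thesis using less.hyps[OF _ e' d0 eq] x' by blast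
  qed
qed


lemma degree_pderiv_less:
  fixes p :: "'a::idom poly"
  shows "pderiv p = 0 \<or> degree (pderiv p) < degree p"
proof (cases "degree p = 0")
  case True
  then obtain a where "p = [:a:]" by (rule degree_eq_zeroE)
  then show ?thesis by simp
next
  case False
  have "degree (pderiv p) < degree p"
    by (rule degree_lessI) (use False in \<open>auto simp: coeff_pderiv coeff_eq_0\<close>)
  then show ?thesis ..
qed

text \<open>
  What remains of the derivative of \<open>g^(k+1) x\<^sup>3\<close> after the obvious factor \<open>g^k x\<^sup>2\<close> is taken out.
\<close>

definition wronskian_cube :: "nat \<Rightarrow> 'a::field poly \<Rightarrow> 'a poly \<Rightarrow> 'a poly" where
  "wronskian_cube k g x = smult (of_nat (Suc k)) (pderiv g * x) + smult 3 (g * pderiv x)"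

lemma pderiv_power_mult_cube:
  "pderiv (g ^ Suc k * x ^ 3) = g ^ k * x\<^sup>2 * wronskian_cube k g x"
proof -
  show ?thesis
    unfolding pderiv_mult pderiv_power_Suc pderiv_cube wronskian_cube_def
    by (simp add: algebra_simps power2_eq_square power3_eq_cube smult_add_right)
qed

lemma degree_wronskian_cube_less:
  assumes "wronskian_cube k g x \<noteq> 0"
  shows "degree (wronskian_cube k g x) < degree g + degree x"
proof (rule degree_lessI)
  have c: "coeff (pderiv p * q) i = 0" if "i \<ge> degree p + degree q" for p q :: "'a poly" and i
  proof (cases "pderiv p * q = 0")
    case False
    then have "degree (pderiv p * q) < degree p + degree q"
      using degree_pderiv_less[of p] by (auto simp: degree_mult_eq)
    with that show ?thesis by (simp add: coeff_eq_0)
  qed (simp only: coeff_0)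
  have "coeff (pderiv g * x) i = 0 \<and> coeff (g * pderiv x) i = 0" if "i \<ge> degree g + degree x" for i
    using c[of g x i] c[of x g i] that by (simp add: mult.commute add.commute)
  then show "\<forall>i\<ge>degree g + degree x. coeff (wronskian_cube k g x) i = 0"
    unfolding wronskian_cube_def by simp
qed (use assms in simp)

text \<open>
  This is the argument behind the Mason-Stothers theorem. The two sides of the
  differentiated equation are divisible by \<open>g^k x\<^sup>2\<close> and by \<open>h^k y\<^sup>2\<close>; the equation itself is a
  Bezout identity for these polynomials, since \<open>c\<close> is a unit, so \<open>h^k y\<^sup>2\<close> divides the cofactor
  \<open>wronskian_cube k g x\<close>, whose degree is small.
\<close>

lemma separable_solution_degree_bound:
  fixes g h :: "'a::field poly"
  assumes "degree g > 0" "degree g < degree h" "c \<noteq> 0"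
    and eq: "g ^ Suc k * x ^ 3 - h ^ Suc k * y ^ 3 = [:c:]" and "pderiv (g ^ Suc k * x ^ 3) \<noteq> 0"
  shows "k * degree h + 2 * degree y < degree g + degree x"
    and "Suc k * degree g + 3 * degree x = Suc k * degree h + 3 * degree y"
proof -
  let ?w = "wronskian_cube k g x" and ?v = "wronskian_cube k h y"
  have nz: "g \<noteq> 0" "h \<noteq> 0" "x \<noteq> 0" using assms(1,2,5) by auto
  have w0: "?w \<noteq> 0" using assms(5) unfolding pderiv_power_mult_cube by auto
  have "pderiv (g ^ Suc k * x ^ 3) - pderiv (h ^ Suc k * y ^ 3) = 0"
    unfolding pderiv_diff[symmetric] eq by simp
  then have d: "g ^ k * x\<^sup>2 * ?w = h ^ k * y\<^sup>2 * ?v" unfolding pderiv_power_mult_cube by simp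
  \<comment> \<open>Substituting the equation for \<open>c\<close> exhibits \<open>h^k y\<^sup>2\<close> as a factor of \<open>c\<close> times the cofactor.\<close>
  have "smult c ?w = [:c:] * ?w" by simp
  also have "\<dots> = (g ^ k * x\<^sup>2 * ?w) * (g * x) - h ^ k * y\<^sup>2 * (h * y * ?w)"
    unfolding eq[symmetric] by (simp add: algebra_simps power2_eq_square power3_eq_cube)
  also have "\<dots> = h ^ k * y\<^sup>2 * (?v * (g * x) - h * y * ?w)"
    unfolding d by (simp add: algebra_simps)
  finally have "h ^ k * y\<^sup>2 dvd smult c ?w" by simp
  then have dvd: "h ^ k * y\<^sup>2 dvd ?w" using assms(3) by (simp add: dvd_smult_iff)
  then have "y \<noteq> 0" using w0 by auto
  have "k * degree h + 2 * degree y = degree (h ^ k * y\<^sup>2)"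
    using nz \<open>y \<noteq> 0\<close> by (simp add: degree_mult_eq degree_power_eq)
  also have "\<dots> \<le> degree ?w" using dvd w0 by (rule dvd_imp_degree_le)
  also have "\<dots> < degree g + degree x" using w0 by (rule degree_wronskian_cube_less)
  finally show "k * degree h + 2 * degree y < degree g + degree x" .
  have "degree (g ^ Suc k * x ^ 3) = Suc k * degree g + 3 * degree x"
    using nz by (subst degree_mult_eq) (simp_all add: degree_power_eq del: power_Suc)
  moreover have "degree (h ^ Suc k * y ^ 3) = Suc k * degree h + 3 * degree y"
    using nz \<open>y \<noteq> 0\<close> by (subst degree_mult_eq) (simp_all add: degree_power_eq del: power_Suc)
  moreover have "degree (g ^ Suc k * x ^ 3) = degree (h ^ Suc k * y ^ 3)"
  proof -
    have "g ^ Suc k * x ^ 3 = h ^ Suc k * y ^ 3 + [:c:]" using eq by (simp add: algebra_simps)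
    moreover have "degree (h ^ Suc k * y ^ 3 + [:c:]) = degree (h ^ Suc k * y ^ 3)"
      by (rule degree_add_eq_left) (use assms(2) calculation(1) in \<open>simp add: \<open>degree (h ^ Suc k * y ^ 3) = _\<close> del: power_Suc\<close>)
    ultimately show ?thesis by simp
  qed
  ultimately show "Suc k * degree g + 3 * degree x = Suc k * degree h + 3 * degree y" by simp
qed

text \<open>
  For the exponent \<open>2\<close> the degree bounds would imply \<open>deg h < deg g\<close>. Hence the separable solution
  has exponent \<open>1\<close>, and \<open>y\<close> can be made monic because the constant on the right is arbitrary.
\<close>

lemma exists_small_solution:
  fixes g h :: "'a::{field,finite} poly"
  assumes "CHAR('a) \<noteq> 3" "squarefree g" "squarefree h" "degree g > 0" "degree g < degree h"
    and "is_unit (g * x ^ 3 - h * y ^ 3)"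
  shows "\<exists>x y c. c \<noteq> 0 \<and> g * x ^ 3 - h * y ^ 3 = [:c:] \<and> lead_coeff y = 1 \<and>
    3 * degree y < 2 * degree g + degree h \<and> degree g + 3 * degree x = degree h + 3 * degree y"
proof -
  obtain c where c: "c \<noteq> 0" "g ^ 1 * x ^ 3 - h ^ 1 * y ^ 3 = [:c:]"
  proof -
    obtain c where "g * x ^ 3 - h * y ^ 3 = [:c:]" "c dvd 1"
      using assms(6) unfolding is_unit_poly_iff by blast
    moreover from this(2) have "c \<noteq> 0" by (metis dvd_0_left zero_neq_one)
    ultimately show ?thesis using that[of c] by simp
  qed
  have "degree h > 0" using assms(5) by simp
  from exists_separable_solution[OF assms(1-4) this _ c]
  obtain e x y c where e: "e \<in> {1, 2}" and c: "c \<noteq> 0" and eq: "g ^ e * x ^ 3 - h ^ e * y ^ 3 = [:c:]"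
    and sep: "pderiv (g ^ e * x ^ 3) \<noteq> 0" by blast
  obtain k where k: "e = Suc k" "k \<le> 1" using e by (cases e) auto
  note bounds = separable_solution_degree_bound[OF assms(4,5) c eq[unfolded k] sep[unfolded k]]
  have k0: "k = 0"
  proof (rule ccontr)
    assume "k \<noteq> 0"
    then have "k = 1" using k by simp
    with bounds assms(5) show False by simp
  qed
  define u where "u = lead_coeff y"
  have "y \<noteq> 0"
  proof
    assume "y = 0"
    then have gx: "g * x ^ 3 = [:c:]" using eq k k0 by simp
    then have "degree (g * x ^ 3) = 0" by simp
    moreover have "g * x ^ 3 \<noteq> 0" using gx c by simp
    ultimately show False using assms(4) by (auto simp: degree_mult_eq)
  qed
  then have u: "u \<noteq> 0" unfolding u_def by simp
  define x1 y1 c1 where "x1 = smult (inverse u) x" and "y1 = smult (inverse u) y" and "c1 = c / u ^ 3"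
  have "g * x1 ^ 3 - h * y1 ^ 3 = smult (inverse u ^ 3) (g * x ^ 3 - h * y ^ 3)"
    by (simp add: x1_def y1_def smult_power smult_diff_right)
  also have "\<dots> = [:c1:]" using eq k k0 by (simp add: c1_def field_simps)
  finally have "g * x1 ^ 3 - h * y1 ^ 3 = [:c1:]" .
  moreover have "c1 \<noteq> 0" using c u by (simp add: c1_def)
  moreover have "lead_coeff y1 = 1" using u by (simp add: y1_def u_def[symmetric])
  moreover have "degree x1 = degree x" "degree y1 = degree y" using u by (simp_all add: x1_def y1_def)
  ultimately show ?thesis using bounds k0 by (intro exI[of _ x1] exI[of _ y1] exI[of _ c1]) simp
qed

section \<open>Cube roots modulo cubes\<close>

text \<open>
  Phrased in terms of coefficients, so that the zero polynomial belongs to it even for \<open>n = 0\<close>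
  and it has \<open>q^n\<close> elements for every \<open>n\<close> if \<open>F\<close> has \<open>q\<close> elements.
\<close>

definition polys_below :: "nat \<Rightarrow> 'a::zero poly set" where
  "polys_below n = {p. \<forall>i\<ge>n. coeff p i = 0}"

lemma polys_below_iff: "p \<in> polys_below n \<longleftrightarrow> p = 0 \<or> degree p < n"
proof
  assume p: "p \<in> polys_below n"
  show "p = 0 \<or> degree p < n"
  proof (rule ccontr)
    assume "\<not> ?thesis"
    then have "p \<noteq> 0" "degree p \<ge> n" by auto
    with p have "lead_coeff p = 0" by (auto simp: polys_below_def)
    with \<open>p \<noteq> 0\<close> show False by simp
  qed
qed (auto simp: polys_below_def coeff_eq_0)

lemma polys_below_Suc: "polys_below (Suc n) = (\<lambda>(a, p). pCons a p) ` (UNIV \<times> polys_below n)"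
proof (intro equalityI subsetI)
  fix p :: "'a poly"
  assume p: "p \<in> polys_below (Suc n)"
  obtain a q where pq: "p = pCons a q" by (cases p)
  have "coeff q i = coeff p (Suc i)" for i unfolding pq by simp
  with p have "q \<in> polys_below n" by (simp add: polys_below_def)
  with pq show "p \<in> (\<lambda>(a, p). pCons a p) ` (UNIV \<times> polys_below n)" by auto
qed (auto simp: polys_below_def coeff_pCons split: nat.splits)

lemma finite_card_polys_below:
  "finite (polys_below n :: 'a::{zero,finite} poly set) \<and>
    card (polys_below n :: 'a poly set) = CARD('a) ^ n"
proof (induction n)
  case 0
  have "polys_below 0 = {0 :: 'a poly}" by (auto simp: polys_below_iff)
  then show ?case by simp
next
  case (Suc n)
  have "inj_on (\<lambda>(a, p). pCons a p) (UNIV \<times> (polys_below n :: 'a poly set))"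
    by (auto simp: inj_on_def)
  then show ?case unfolding polys_below_Suc using Suc
    by (simp add: card_image card_cartesian_product)
qed

lemmas finite_polys_below [simp, intro] = finite_card_polys_below[THEN conjunct1]
lemmas card_polys_below = finite_card_polys_below[THEN conjunct2]

definition monics :: "nat \<Rightarrow> 'a::comm_ring_1 poly set" where
  "monics n = {p. lead_coeff p = 1 \<and> degree p = n}"

lemma monics_eq: "monics n = (\<lambda>w. monom 1 n + w) ` polys_below n"
proof (intro equalityI subsetI)
  fix p :: "'a poly"
  assume p: "p \<in> monics n"
  then have "p - monom 1 n \<in> polys_below n"
    by (auto simp: monics_def polys_below_def coeff_eq_0)
  then show "p \<in> (\<lambda>w. monom 1 n + w) ` polys_below n" by (intro image_eqI[of _ _ "p - monom 1 n"]) simp_all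
next
  fix p :: "'a poly"
  assume "p \<in> (\<lambda>w. monom 1 n + w) ` polys_below n"
  then obtain w where w: "p = monom 1 n + w" "w \<in> polys_below n" by blast
  have c: "coeff p n = 1" "\<And>i. i > n \<Longrightarrow> coeff p i = 0"
    using w by (simp_all add: polys_below_def)
  then have "degree p = n" by (intro antisym degree_le le_degree) auto
  with c show "p \<in> monics n" by (simp add: monics_def)
qed

lemma finite_monics [simp, intro]: "finite (monics n :: 'a::{comm_ring_1,finite} poly set)"
  and card_monics: "card (monics n :: 'a poly set) = CARD('a) ^ n"
  unfolding monics_eq by (simp_all add: card_image inj_on_def card_polys_below)

text \<open>
  The number of values of \<open>f\<close> is bounded through sets of representatives, which is how the
  counts of incongruent solutions below are phrased.
\<close>

lemma card_le_mult_fibres: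
  assumes "\<And>U. U \<subseteq> S \<Longrightarrow> inj_on f U \<Longrightarrow> finite U \<and> card U \<le> K"
    and "\<And>v. finite {x \<in> S. f x = v} \<and> card {x \<in> S. f x = v} \<le> L"
  shows "finite S \<and> card S \<le> K * L"
proof -
  obtain U where U: "U \<subseteq> S" "inj_on f U" "f ` S = f ` U"
    using subset_image_inj[of "f ` S" f S] by auto
  from assms(1)[OF U(1,2)] have fin: "finite U" and le: "card U \<le> K" by auto
  have S: "S = (\<Union>v\<in>f ` U. {x \<in> S. f x = v})" using U(3) by auto
  have "finite S" by (subst S) (use fin assms(2) in auto)
  moreover have "card S \<le> (\<Sum>v\<in>f ` U. card {x \<in> S. f x = v})"
    by (subst S) (rule card_UN_le, use fin in simp)
  moreover have "\<dots> \<le> (\<Sum>v\<in>f ` U. L)" using assms(2) by (intro sum_mono) simp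
  moreover have "\<dots> = card U * L" using U(2) by (simp add: card_image)
  moreover have "\<dots> \<le> K * L" using le by simp
  ultimately show ?thesis by linarith
qed

lemma div_in_polys_below:
  fixes z M :: "'a::field poly"
  assumes "M \<noteq> 0" "z \<in> polys_below n"
  shows "z div M \<in> polys_below (n - degree M)"
proof (cases "z div M = 0")
  case False
  have "degree (z mod M) < degree (M * (z div M)) \<or> z mod M = 0"
    using degree_mod_less[OF assms(1), of z] False assms(1) by (auto simp: degree_mult_eq)
  then have "degree (M * (z div M) + z mod M) = degree (M * (z div M))"
    by (elim disjE) (simp_all only: degree_add_eq_left add_0_right)
  then have "degree z = degree M + degree (z div M)"
    using False assms(1) by (simp add: degree_mult_eq)
  moreover have "z \<noteq> 0" using False by auto
  ultimately show ?thesis using assms(2) by (auto simp: polys_below_iff)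
qed (simp add: polys_below_def)

text \<open>
  Each residue class contains at most \<open>q^(n - deg M)\<close> polynomials of degree less than \<open>n\<close>, as these are
  determined by their quotients. The truncated subtraction accounts for the case
  \<open>deg M > n\<close>, where a class contains at most one. The offset \<open>a\<close> allows affine families such as
  the monic polynomials.
\<close>

lemma card_residue_classes_le:
  fixes S :: "'a::{field,finite} poly set"
  assumes "M \<noteq> 0" "S \<subseteq> polys_below n"
    and "\<And>U. U \<subseteq> S \<Longrightarrow> inj_on (\<lambda>z. (a + z) mod M) U \<Longrightarrow> card U \<le> K"
  shows "card S \<le> K * CARD('a) ^ (n - degree M)"
proof -
  have finS: "finite S" using assms(2) finite_subset by blast
  have "finite {x \<in> S. (a + x) mod M = v} \<and>
    card {x \<in> S. (a + x) mod M = v} \<le> CARD('a) ^ (n - degree M)" for v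
  proof
    let ?F = "{x \<in> S. (a + x) mod M = v}"
    show "finite ?F" using finS by simp
    have "inj_on (\<lambda>z. z div M) ?F"
    proof (rule inj_onI)
      fix x y assume xy: "x \<in> ?F" "y \<in> ?F" "x div M = y div M"
      then have "(a + x) mod M = (a + y) mod M" by simp
      then have "M dvd (a + x) - (a + y)" by (simp only: mod_eq_dvd_iff)
      then have "x mod M = y mod M" by (simp add: mod_eq_dvd_iff)
      with xy(3) show "x = y" by (metis div_mult_mod_eq)
    qed
    then have "card ?F = card ((\<lambda>z. z div M) ` ?F)" by (simp add: card_image)
    also have "\<dots> \<le> card (polys_below (n - degree M) :: 'a poly set)"
      by (intro card_mono image_subsetI div_in_polys_below[OF assms(1)]) (use assms(2) in auto)
    finally show "card ?F \<le> CARD('a) ^ (n - degree M)" by (simp add: card_polys_below)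
  qed
  from card_le_mult_fibres[OF _ this] assms(3) show ?thesis
    using finS finite_subset by blast
qed

lemma card_le_1_of_all_eq:
  assumes "\<And>x y. x \<in> T \<Longrightarrow> y \<in> T \<Longrightarrow> x = y"
  shows "finite T \<and> card T \<le> 1"
proof (cases "T = {}")
  case False
  then obtain x where "x \<in> T" by blast
  with assms have "T = {x}" by blast
  then show ?thesis by simp
qed simp

text \<open>
  As in a field: \<open>P\<close> is coprime to \<open>3 g x\<close>, so it cannot divide both factors of
  \<open>x\<^sup>3 - x'\<^sup>3 = (x - x') (x\<^sup>2 + x x' + x'\<^sup>2)\<close>. Hence two incongruent roots are incongruent even modulo
  \<open>P\<close> and annihilate the second factor modulo \<open>P^k\<close>; three of them add up to zero, which determines
  the third from the first two.
\<close>

lemma card_cube_solutions_prime_power: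
  fixes P g u :: "'a::field poly"
  assumes "CHAR('a) \<noteq> 3" "prime_elem P" "is_unit u"
    and sol: "\<And>x. x \<in> T \<Longrightarrow> P ^ k dvd g * x ^ 3 - u"
    and inj: "inj_on (\<lambda>x. x mod P ^ k) T"
  shows "finite T \<and> card T \<le> 3"
proof (cases "k = 0")
  case True
  have "finite T \<and> card T \<le> 1"
    by (rule card_le_1_of_all_eq) (use inj True in \<open>auto simp: inj_on_def\<close>)
  then show ?thesis by simp
next
  case False
  have Pu: "\<not> P dvd u" using assms(2,3) by (auto simp: prime_elem_def dest: dvd_unit_imp_unit)
  have PPk: "P dvd P ^ k" using False by (simp add: dvd_power)
  have Pgx: "\<not> P dvd g * x ^ 3" if "x \<in> T" for x
  proof
    assume "P dvd g * x ^ 3"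
    moreover have "P dvd g * x ^ 3 - u" using sol[OF that] PPk dvd_trans by blast
    ultimately have "P dvd g * x ^ 3 - (g * x ^ 3 - u)" by (rule dvd_diff)
    with Pu show False by simp
  qed
  have Pg: "\<not> P dvd g" if "x \<in> T" for x using Pgx[OF that] by (meson dvd_mult2)
  have Px: "\<not> P dvd x" if "x \<in> T" for x
    using Pgx[OF that] by (auto simp: power3_eq_cube)
  have P3: "\<not> P dvd 3" using assms(1,2) by (rule prime_elem_not_dvd_3)
  have ncong: "\<not> P ^ k dvd x - x'" if "x \<in> T" "x' \<in> T" "x \<noteq> x'" for x x'
    using inj that by (auto simp: inj_on_def mod_eq_dvd_iff)
  have quad: "P ^ k dvd x\<^sup>2 + x * x' + x'\<^sup>2 \<and> \<not> P dvd x - x'" if T: "x \<in> T" "x' \<in> T" "x \<noteq> x'" for x x'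
  proof -
    have "P ^ k dvd (g * x ^ 3 - u) - (g * x' ^ 3 - u)" by (rule dvd_diff[OF sol[OF T(1)] sol[OF T(2)]])
    also have "(g * x ^ 3 - u) - (g * x' ^ 3 - u) = g * ((x - x') * (x\<^sup>2 + x * x' + x'\<^sup>2))"
      by (simp add: algebra_simps power2_eq_square power3_eq_cube)
    finally have d: "P ^ k dvd (x - x') * (x\<^sup>2 + x * x' + x'\<^sup>2)"
      using prime_elem_power_dvd_mult_cancel[OF assms(2) Pg[OF T(1)]] by blast
    have "\<not> P dvd x - x'"
    proof
      assume 1: "P dvd x - x'"
      have "\<not> P dvd x\<^sup>2 + x * x' + x'\<^sup>2"
      proof
        assume "P dvd x\<^sup>2 + x * x' + x'\<^sup>2"
        then have "P dvd (x\<^sup>2 + x * x' + x'\<^sup>2) - (x - x') * (x + 2 * x')"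
          using 1 by (intro dvd_diff) auto
        also have "\<dots> = 3 * x'\<^sup>2" by (simp add: algebra_simps power2_eq_square)
        finally show False using P3 Px[OF T(2)] assms(2)
          by (simp add: prime_elem_dvd_mult_iff prime_elem_dvd_power_iff)
      qed
      from prime_elem_power_dvd_mult_cancel[OF assms(2) this] d ncong[OF T]
      show False by (metis mult.commute)
    qed
    with prime_elem_power_dvd_mult_cancel[OF assms(2) this d] show ?thesis by simp
  qed
  have sum0: "P ^ k dvd x0 + x1 + x2"
    if "x0 \<in> T" "x1 \<in> T" "x2 \<in> T" "x0 \<noteq> x1" "x0 \<noteq> x2" "x1 \<noteq> x2" for x0 x1 x2
  proof -
    have "P ^ k dvd (x1\<^sup>2 + x1 * x0 + x0\<^sup>2) - (x2\<^sup>2 + x2 * x0 + x0\<^sup>2)"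
      using quad[of x1 x0] quad[of x2 x0] that by (intro dvd_diff) auto
    also have "\<dots> = (x1 - x2) * (x0 + x1 + x2)" by (simp add: algebra_simps power2_eq_square)
    finally show ?thesis
      using prime_elem_power_dvd_mult_cancel[OF assms(2)] quad[of x1 x2] that by blast
  qed
  have "\<exists>x0 x1 x2. T \<subseteq> {x0, x1, x2}"
  proof (rule ccontr)
    assume n: "\<not> ?thesis"
    then obtain x0 where x0: "x0 \<in> T" by blast
    from n obtain x1 where x1: "x1 \<in> T" "x1 \<noteq> x0" by blast
    from n obtain x2 where x2: "x2 \<in> T" "x2 \<noteq> x0" "x2 \<noteq> x1" by blast
    from n obtain x3 where x3: "x3 \<in> T" "x3 \<noteq> x0" "x3 \<noteq> x1" "x3 \<noteq> x2" by blast
    have "P ^ k dvd (x0 + x1 + x2) - (x0 + x1 + x3)"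
      using x0 x1 x2 x3 by (intro dvd_diff sum0) auto
    then have "P ^ k dvd x2 - x3" by simp
    with ncong x2 x3 show False by blast
  qed
  then obtain x0 x1 x2 where T: "T \<subseteq> {x0, x1, x2}" by blast
  then have "card T \<le> card {x0, x1, x2}" by (intro card_mono) auto
  also have "\<dots> \<le> 3" by (auto simp: card_insert_if)
  finally show ?thesis using T finite_subset by blast
qed

text \<open>
  Factorisations of \<open>y\<close> into three monic factors. Their number is at least \<open>3\<close> to the power of the number of
  prime divisors of \<open>y\<close>, and it is easier to sum over \<open>y\<close>.
\<close>

definition triples :: "'a::comm_ring_1 poly \<Rightarrow> ('a poly \<times> 'a poly \<times> 'a poly) set" where
  "triples y = {(a, b, c). lead_coeff a = 1 \<and> lead_coeff b = 1 \<and> lead_coeff c = 1 \<and> a * b * c = y}"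

definition triples_deg :: "nat \<Rightarrow> ('a::comm_ring_1 poly \<times> 'a poly \<times> 'a poly) set" where
  "triples_deg d = (\<Union>(i, j) \<in> {(i, j) \<in> {..d} \<times> {..d}. i + j \<le> d}. monics i \<times> monics j \<times> monics (d - i - j))"

lemma triples_subset: "triples (y :: 'a::{field,finite} poly) \<subseteq> triples_deg (degree y)"
proof
  fix t assume "t \<in> triples y"
  then obtain a b c where t: "t = (a, b, c)" "lead_coeff a = 1" "lead_coeff b = 1" "lead_coeff c = 1"
    "a * b * c = y" by (auto simp: triples_def)
  then have "a \<noteq> 0" "b \<noteq> 0" "c \<noteq> 0" by auto
  then have "degree y = degree a + degree b + degree c"
    by (simp add: degree_mult_eq flip: t(5))
  with t show "t \<in> triples_deg (degree y)" unfolding triples_deg_def monics_def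
    by (auto intro!: bexI[of _ "(degree a, degree b)"])
qed

lemma finite_triples_deg: "finite (triples_deg d :: ('a::{field,finite} poly \<times> _) set)"
  unfolding triples_deg_def by (intro finite_UN_I) (auto intro: finite_subset[of _ "{..d} \<times> {..d}"])

lemma finite_triples: "finite (triples (y :: 'a::{field,finite} poly))"
  using triples_subset finite_triples_deg finite_subset by blast

lemma card_triples_deg_le:
  "card (triples_deg d :: ('a::{field,finite} poly \<times> _) set) \<le> (d + 1)\<^sup>2 * CARD('a) ^ d"
proof -
  let ?I = "{(i, j) \<in> {..d} \<times> {..d}. i + j \<le> d}"
  have fin: "finite ?I" by (rule finite_subset[of _ "{..d} \<times> {..d}"]) auto
  have "card (triples_deg d :: ('a poly \<times> 'a poly \<times> 'a poly) set) \<le>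
    (\<Sum>(i, j)\<in>?I. card (monics i \<times> monics j \<times> monics (d - i - j) :: ('a poly \<times> 'a poly \<times> 'a poly) set))"
    unfolding triples_deg_def by (rule order_trans[OF card_UN_le[OF fin]]) (simp add: split_def)
  also have "\<dots> = (\<Sum>(i, j)\<in>?I. CARD('a) ^ d)"
    by (intro sum.cong) (auto simp: card_cartesian_product card_monics simp flip: power_add)
  also have "\<dots> = card ?I * CARD('a) ^ d" by (simp add: split_def)
  also have "card ?I \<le> card ({..d} \<times> {..d})" by (intro card_mono) auto
  then have "card ?I * CARD('a) ^ d \<le> (d + 1)\<^sup>2 * CARD('a) ^ d"
    by (intro mult_right_mono) (simp_all add: card_cartesian_product power2_eq_square)
  finally show ?thesis .
qed

lemma sum_card_triples_le:
  "(\<Sum>y\<in>monics d. card (triples (y :: 'a::{field,finite} poly))) \<le> (d + 1)\<^sup>2 * CARD('a) ^ d"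
proof -
  have "(\<Sum>y\<in>monics d. card (triples (y :: 'a poly))) = card (\<Union>y\<in>monics d. triples (y :: 'a poly))"
    by (rule card_UN_disjoint[symmetric]) (auto simp: finite_triples, auto simp: triples_def)
  also have "\<dots> \<le> card (triples_deg d :: ('a poly \<times> 'a poly \<times> 'a poly) set)"
    by (intro card_mono finite_triples_deg UN_least)
      (use triples_subset in \<open>auto simp: monics_def\<close>)
  finally show ?thesis using card_triples_deg_le order_trans by blast
qed

text \<open>
  The prime power \<open>Q\<close> can be multiplied into any of the three factors, and the position is
  recovered as the one divisible by \<open>P\<close>.
\<close>

lemma three_mult_card_triples_le:
  fixes P y :: "'a::{field,finite} poly"
  assumes "prime_elem P" "P dvd Q" "lead_coeff Q = 1" "\<not> P dvd y"
  shows "3 * card (triples y) \<le> card (triples (Q * y))"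
proof -
  have Q0: "Q \<noteq> 0" using assms(3) by auto
  define f1 f2 f3 :: "'a poly \<times> 'a poly \<times> 'a poly \<Rightarrow> 'a poly \<times> 'a poly \<times> 'a poly"
    where "f1 = (\<lambda>(a, b, c). (Q * a, b, c))" and "f2 = (\<lambda>(a, b, c). (a, Q * b, c))"
      and "f3 = (\<lambda>(a, b, c). (a, b, Q * c))"
  note defs = f1_def f2_def f3_def
  have inj: "inj_on f1 (triples y)" "inj_on f2 (triples y)" "inj_on f3 (triples y)"
    using Q0 by (auto simp: defs inj_on_def)
  have nd: "\<not> P dvd a" "\<not> P dvd b" "\<not> P dvd c" if "(a, b, c) \<in> triples y" for a b c
    using that assms(4) by (auto simp: triples_def intro: dvd_mult dvd_mult2)
  have "P dvd Q * z" for z using assms(2) by simp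
  then have m: "t \<in> f1 ` triples y \<Longrightarrow> P dvd fst t \<and> \<not> P dvd snd (snd t)"
    "t \<in> f2 ` triples y \<Longrightarrow> \<not> P dvd fst t \<and> \<not> P dvd snd (snd t)"
    "t \<in> f3 ` triples y \<Longrightarrow> P dvd snd (snd t)" for t
    using nd by (auto simp only: defs prod.case fst_conv snd_conv image_iff)
  have disj: "f1 ` triples y \<inter> f2 ` triples y = {}"
    "(f1 ` triples y \<union> f2 ` triples y) \<inter> f3 ` triples y = {}"
    using m by blast+
  have "card (f1 ` triples y \<union> f2 ` triples y \<union> f3 ` triples y) = 3 * card (triples y)"
    using disj inj by (simp add: card_Un_disjoint finite_triples card_image)
  moreover have "f1 ` triples y \<union> f2 ` triples y \<union> f3 ` triples y \<subseteq> triples (Q * y)"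
    using assms(3) by (auto simp: defs triples_def lead_coeff_mult)
  ultimately show ?thesis by (metis card_mono finite_triples)
qed

lemma prime_elem_decompose:
  fixes P y :: "'a::field poly"
  assumes "prime_elem P" "y \<noteq> 0"
  shows "\<exists>k y'. y = P ^ k * y' \<and> \<not> P dvd y'"
  using assms(2)
proof (induction "degree y" arbitrary: y rule: less_induct)
  case less
  show ?case
  proof (cases "P dvd y")
    case False
    then show ?thesis by (intro exI[of _ 0] exI[of _ y]) simp
  next
    case True
    then obtain z where z: "y = P * z" by blast
    have "z \<noteq> 0" "P \<noteq> 0" using z less.prems by auto
    then have "degree z < degree y"
      using z prime_elem_degree_pos[OF assms(1)] by (simp add: degree_mult_eq)
    from less.hyps[OF this \<open>z \<noteq> 0\<close>] obtain k y' where "z = P ^ k * y'" "\<not> P dvd y'" by blast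
    then show ?thesis using z by (intro exI[of _ "Suc k"] exI[of _ y']) (simp add: mult_ac)
  qed
qed

text \<open>
  Induction over the prime powers in \<open>y\<close>, with the Chinese remainder theorem in the form that a
  polynomial divisible by two coprime moduli is divisible by their product.
\<close>

lemma card_cube_solutions:
  fixes g u y :: "'a::{field,finite} poly"
  assumes "CHAR('a) \<noteq> 3" "is_unit u" "lead_coeff y = 1"
    and "\<And>x. x \<in> T \<Longrightarrow> y ^ 3 dvd g * x ^ 3 - u"
    and "inj_on (\<lambda>x. x mod y ^ 3) T"
  shows "finite T \<and> card T \<le> card (triples y)"
  using assms(3-5)
proof (induction "degree y" arbitrary: y T rule: less_induct)
  case less
  show ?case
  proof (cases "degree y = 0")
    case True
    then obtain s where "y = [:s:]" by (rule degree_eq_zeroE)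
    with less.prems(1) have y: "y = 1" by (simp add: one_pCons)
    have "finite T \<and> card T \<le> 1"
      by (rule card_le_1_of_all_eq) (use less.prems(3) in \<open>auto simp: inj_on_def y\<close>)
    moreover have "(1, 1, 1) \<in> triples y" by (simp add: triples_def y)
    then have "card (triples y) \<ge> 1"
      using finite_triples[of y] by (auto simp: Suc_le_eq card_gt_0_iff)
    ultimately show ?thesis by simp
  next
    case False
    then have "degree y > 0" by simp
    then obtain P where P: "prime_elem P" and lP: "lead_coeff P = 1" and Py: "P dvd y"
      by (rule exists_monic_prime_elem_dvd_poly)
    have y0: "y \<noteq> 0" using False by auto
    obtain k y' where k: "y = P ^ k * y'" "\<not> P dvd y'"
      using prime_elem_decompose[OF P y0] by blast
    have "k \<noteq> 0" using k Py by (cases k) auto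
    then have PQ: "P dvd P ^ k" by (simp add: dvd_power)
    have lQ: "lead_coeff (P ^ k) = 1" using lP by (simp add: lead_coeff_power)
    have ly': "lead_coeff y' = 1" using less.prems(1) k lQ by (simp add: lead_coeff_mult)
    have Q0: "P ^ k \<noteq> 0" "y' \<noteq> 0" using P ly' by auto
    have "degree (P ^ k) > 0"
      using \<open>k \<noteq> 0\<close> prime_elem_degree_pos[OF P] P by (simp add: degree_power_eq prime_elem_def)
    then have deg: "degree y' < degree y" unfolding k using Q0 by (simp add: degree_mult_eq)
    have y3: "y ^ 3 = P ^ (k * 3) * y' ^ 3" by (simp add: k power_mult_distrib power_mult)
    have "finite T \<and> card T \<le> 3 * card (triples y')"
    proof (rule card_le_mult_fibres[where f = "\<lambda>x. x mod P ^ (k * 3)"])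
      fix U assume U: "U \<subseteq> T" "inj_on (\<lambda>x. x mod P ^ (k * 3)) U"
      show "finite U \<and> card U \<le> 3"
      proof (rule card_cube_solutions_prime_power[OF assms(1) P assms(2) _ U(2)])
        fix x assume "x \<in> U"
        with U less.prems(2) have "y ^ 3 dvd g * x ^ 3 - u" by blast
        then show "P ^ (k * 3) dvd g * x ^ 3 - u" unfolding y3 by (rule dvd_mult_left)
      qed
    next
      fix v
      let ?F = "{x \<in> T. x mod P ^ (k * 3) = v}"
      show "finite ?F \<and> card ?F \<le> card (triples y')"
      proof (rule less.hyps[OF deg ly'])
        fix x assume "x \<in> ?F"
        with less.prems(2) have "y ^ 3 dvd g * x ^ 3 - u" by blast
        then show "y' ^ 3 dvd g * x ^ 3 - u" unfolding y3 by (rule dvd_mult_right)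
      next
        show "inj_on (\<lambda>x. x mod y' ^ 3) ?F"
        proof (rule inj_onI)
          fix x z assume xz: "x \<in> ?F" "z \<in> ?F" "x mod y' ^ 3 = z mod y' ^ 3"
          then have 1: "P ^ (k * 3) dvd x - z" "y' ^ 3 dvd x - z" by (simp_all flip: mod_eq_dvd_iff)
          then obtain w where w: "x - z = y' ^ 3 * w" by blast
          have "\<not> P dvd y' ^ 3" using k(2) P prime_elem_dvd_power by blast
          from prime_elem_power_dvd_mult_cancel[OF P this 1(1)[unfolded w]]
          have "P ^ (k * 3) dvd w" .
          then have "y ^ 3 dvd x - z" unfolding y3 w
            by (subst mult.commute) (rule mult_dvd_mono[OF dvd_refl])
          then have "x mod y ^ 3 = z mod y ^ 3" by (simp add: mod_eq_dvd_iff)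
          with less.prems(3) xz show "x = z" by (auto simp: inj_on_def)
        qed
      qed
    qed
    moreover have "3 * card (triples y') \<le> card (triples y)"
      unfolding k(1) by (rule three_mult_card_triples_le[OF P PQ lQ k(2)])
    ultimately show ?thesis by linarith
  qed
qed

section \<open>The upper bound\<close>

text \<open>
  By \<open>monogenic_set_eq\<close> this is \<open>monogenic_set g\<close> under the hypotheses of the theorem; the counting
  arguments refer to the equation only.
\<close>

definition solvable_set :: "'a::field poly \<Rightarrow> 'a poly set" where
  "solvable_set g = {h. squarefree h \<and> coprime g h \<and> (\<exists>x y. is_unit (g * x ^ 3 - h * y ^ 3))}"

lemma card_cube_solutions_below:
  fixes g y :: "'a::{field,finite} poly"
  assumes "CHAR('a) \<noteq> 3" "c \<noteq> 0" "y \<in> monics d"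
  shows "card {x \<in> polys_below n. y ^ 3 dvd g * x ^ 3 - [:c:]} \<le> card (triples y) * CARD('a) ^ (n - 3 * d)"
proof -
  have y: "lead_coeff y = 1" "degree y = d" using assms(3) by (auto simp: monics_def)
  then have y0: "y \<noteq> 0" by auto
  have "degree (y ^ 3) = 3 * d" using y y0 by (simp add: degree_power_eq)
  moreover have "card {x \<in> polys_below n. y ^ 3 dvd g * x ^ 3 - [:c:]}
    \<le> card (triples y) * CARD('a) ^ (n - degree (y ^ 3))"
  proof (rule card_residue_classes_le[where a = 0])
    show "y ^ 3 \<noteq> 0" using y0 by simp
    fix U assume U: "U \<subseteq> {x \<in> polys_below n. y ^ 3 dvd g * x ^ 3 - [:c:]}"
      "inj_on (\<lambda>z. (0 + z) mod y ^ 3) U"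
    have "is_unit [:c:]" using assms(2) by (rule is_unit_triv)
    then show "card U \<le> card (triples y)"
      using card_cube_solutions[OF assms(1) _ y(1), of "[:c:]" U g] U by auto
  qed auto
  ultimately show ?thesis by simp
qed

text \<open>
  The first term covers all \<open>h\<close> of degree at most \<open>deg g\<close>. Every other \<open>h\<close> equals
  \<open>(g x\<^sup>3 - c) / y\<^sup>3\<close> for a small solution, where \<open>y\<close> is monic of degree \<open>d\<close> and the equality of degrees
  bounds \<open>deg x\<close> in terms of \<open>d\<close> and \<open>N\<close>.
\<close>

lemma card_solvable_set_le_sum:
  fixes g :: "'a::{field,finite} poly"
  assumes "CHAR('a) \<noteq> 3" "squarefree g" "degree g > 0"
  defines "q \<equiv> CARD('a)" and "A \<equiv> \<lambda>N. N div 3 + 1" and "D \<equiv> \<lambda>N. (2 * degree g + N) div 3"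
  shows "card (solvable_set g \<inter> {h. degree h \<le> N}) \<le>
    q ^ (degree g + 1) + (\<Sum>d\<le>D N. q * ((d + 1)\<^sup>2 * q ^ d * q ^ (A N + d - 3 * d)))"
proof -
  let ?X = "\<lambda>d y c. {x \<in> polys_below (A N + d). y ^ 3 dvd g * x ^ 3 - [:c:]}"
  let ?I = "\<lambda>d y c. (\<lambda>x. (g * x ^ 3 - [:c:]) div y ^ 3) ` ?X d y c"
  let ?U = "\<Union>d\<le>D N. \<Union>y\<in>monics d. \<Union>c\<in>UNIV - {0}. ?I d y c"
  have fin: "finite (?I d y c)" for d y c
    by (rule finite_imageI, rule finite_subset[of _ "polys_below (A N + d)"]) auto
  have "solvable_set g \<inter> {h. degree h \<le> N} \<subseteq> polys_below (degree g + 1) \<union> ?U"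
  proof
    fix h assume "h \<in> solvable_set g \<inter> {h. degree h \<le> N}"
    then obtain x0 y0 where h: "squarefree h" "is_unit (g * x0 ^ 3 - h * y0 ^ 3)" "degree h \<le> N"
      by (auto simp: solvable_set_def)
    show "h \<in> polys_below (degree g + 1) \<union> ?U"
    proof (cases "degree h \<le> degree g")
      case True
      then show ?thesis by (simp add: polys_below_iff)
    next
      case False
      then have "degree g < degree h" by simp
      from exists_small_solution[OF assms(1,2) h(1) assms(3) this h(2)]
      obtain x y c where s: "c \<noteq> 0" "g * x ^ 3 - h * y ^ 3 = [:c:]" "lead_coeff y = 1"
        "3 * degree y < 2 * degree g + degree h" "degree g + 3 * degree x = degree h + 3 * degree y"
        by blast
      have hy: "g * x ^ 3 - [:c:] = y ^ 3 * h" using s(2) by (simp add: algebra_simps)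
      have "y \<noteq> 0" using s(3) by auto
      then have "h = (g * x ^ 3 - [:c:]) div y ^ 3" unfolding hy by simp
      moreover have "degree x < A N + degree y" using s(5) h(3) unfolding A_def by linarith
      moreover have "y ^ 3 dvd g * x ^ 3 - [:c:]" unfolding hy by simp
      ultimately have "h = (g * x ^ 3 - [:c:]) div y ^ 3" "x \<in> ?X (degree y) y c"
        by (simp_all add: polys_below_iff)
      then have "h \<in> ?I (degree y) y c" by blast
      moreover have "degree y \<le> D N" using s(4) h(3) unfolding D_def by linarith
      moreover have "y \<in> monics (degree y)" using s(3) by (simp add: monics_def)
      ultimately show ?thesis using s(1) by blast
    qed
  qed
  then have "card (solvable_set g \<inter> {h. degree h \<le> N}) \<le> card (polys_below (degree g + 1) \<union> ?U)"
    by (rule card_mono[rotated]) (auto intro!: finite_UN_I fin)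
  also have "\<dots> \<le> q ^ (degree g + 1) + card ?U"
    by (rule order_trans[OF card_Un_le]) (simp add: card_polys_below q_def)
  also have "card ?U \<le> (\<Sum>d\<le>D N. card (\<Union>y\<in>monics d. \<Union>c\<in>UNIV - {0}. ?I d y c))"
    by (rule card_UN_le) simp
  also have "\<dots> \<le> (\<Sum>d\<le>D N. q * ((d + 1)\<^sup>2 * q ^ d * q ^ (A N + d - 3 * d)))"
  proof (rule sum_mono)
    fix d
    let ?r = "q ^ (A N + d - 3 * d)"
    have "card (\<Union>y\<in>monics d. \<Union>c\<in>UNIV - {0}. ?I d y c)
      \<le> (\<Sum>y\<in>monics d. \<Sum>c\<in>UNIV - {0}. card (?I d y c))"
      by (rule order_trans[OF card_UN_le sum_mono]) (auto intro: card_UN_le)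
    also have "\<dots> \<le> (\<Sum>y\<in>monics d. \<Sum>c\<in>UNIV - {0::'a}. card (triples (y :: 'a poly)) * ?r)"
    proof (intro sum_mono)
      fix y :: "'a poly" and c :: 'a
      assume y: "y \<in> monics d" and c: "c \<in> UNIV - {0}"
      have "card (?I d y c) \<le> card (?X d y c)"
        by (rule card_image_le) (rule finite_subset[of _ "polys_below (A N + d)"], auto)
      also have "\<dots> \<le> card (triples y) * ?r"
        unfolding q_def by (rule card_cube_solutions_below) (use assms(1) y c in auto)
      finally show "card (?I d y c) \<le> card (triples y) * ?r" .
    qed
    also have "\<dots> \<le> (\<Sum>y\<in>monics d. q * (card (triples (y :: 'a poly)) * ?r))"
      by (intro sum_mono) (simp add: q_def)
    also have "\<dots> = q * ((\<Sum>y\<in>monics d. card (triples (y :: 'a poly))) * ?r)"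
      by (simp only: sum_distrib_left sum_distrib_right)
    also have "\<dots> \<le> q * ((d + 1)\<^sup>2 * q ^ d * ?r)"
      using sum_card_triples_le[where 'a = 'a, of d] by (simp add: q_def)
    finally show "card (\<Union>y\<in>monics d. \<Union>c\<in>UNIV - {0}. ?I d y c) \<le> q * ((d + 1)\<^sup>2 * q ^ d * ?r)" .
  qed
  finally show ?thesis by simp
qed

lemma sum_powers_le:
  fixes q :: nat
  assumes "q \<ge> 2"
  shows "(\<Sum>d\<le>n. q ^ d) \<le> q ^ (n + 1)"
proof (induction n)
  case (Suc n)
  have "(\<Sum>d\<le>Suc n. q ^ d) \<le> 2 * q ^ (n + 1)" using Suc by simp
  also have "\<dots> \<le> q * q ^ (n + 1)" using assms by (rule mult_right_mono) simp
  finally show ?case by simp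
qed (use assms in simp)

text \<open>
  The summand is \<open>q^(A - d)\<close> while \<open>2 d \<le> A\<close> and \<open>q^d\<close> afterwards, where the truncated exponent
  vanishes; both geometric sums are dominated by their largest terms.
\<close>

lemma sum_truncated_powers_le:
  fixes q :: nat
  assumes "q \<ge> 2"
  shows "(\<Sum>d\<le>D. q ^ d * q ^ (A + d - 3 * d)) \<le> q ^ (A + 1) + q ^ (D + 1)"
proof -
  let ?f = "\<lambda>d. if d \<le> A then q ^ (A - d) else 0"
  have "(\<Sum>d\<le>D. q ^ d * q ^ (A + d - 3 * d)) \<le> (\<Sum>d\<le>D. ?f d + q ^ d)"
  proof (rule sum_mono)
    fix d
    show "q ^ d * q ^ (A + d - 3 * d) \<le> ?f d + q ^ d"
    proof (cases "2 * d \<le> A")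
      case True
      then have "d + (A + d - 3 * d) = A - d" by simp
      then have "q ^ d * q ^ (A + d - 3 * d) = q ^ (A - d)" by (simp flip: power_add)
      then show ?thesis using True by simp
    qed simp
  qed
  also have "\<dots> = (\<Sum>d\<le>D. ?f d) + (\<Sum>d\<le>D. q ^ d)" by (rule sum.distrib)
  also have "(\<Sum>d\<le>D. ?f d) \<le> (\<Sum>d\<in>{..A}. q ^ (A - d))"
    by (simp add: sum.If_cases) (rule sum_mono2, auto)
  also have "\<dots> = (\<Sum>d\<le>A. q ^ d)"
    by (rule sum.reindex_bij_witness[of _ "\<lambda>d. A - d" "\<lambda>d. A - d"]) auto
  also have "\<dots> \<le> q ^ (A + 1)" using assms by (rule sum_powers_le)
  also have "(\<Sum>d\<le>D. q ^ d) \<le> q ^ (D + 1)" using assms by (rule sum_powers_le)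
  finally show ?thesis by simp
qed

lemma CARD_ge_2: "CARD('a::{zero_neq_one,finite}) \<ge> 2"
proof -
  have "card {0, 1 :: 'a} \<le> CARD('a)" by (rule card_mono) auto
  then show ?thesis by simp
qed

lemma solvable_set_upper_bound:
  fixes g :: "'a::{field,finite} poly"
  assumes "CHAR('a) \<noteq> 3" "squarefree g" "degree g > 0"
  shows "\<exists>C>0. \<forall>\<^sub>F N in sequentially. real (card (solvable_set g \<inter> {h. degree h \<le> N}))
    \<le> C * (real N ^ 2 * real CARD('a) powr (real N / 3))"
proof -
  let ?q = "CARD('a)" and ?e = "degree g"
  have q2: "?q \<ge> 2" by (rule CARD_ge_2)
  define C where "C = ?q ^ (?e + 1) + 4 * ?q * (?q ^ 2 + ?q ^ (2 * ?e + 1))"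
  have "real (card (solvable_set g \<inter> {h. degree h \<le> N}))
    \<le> real C * (real N ^ 2 * real ?q powr (real N / 3))" if N: "N \<ge> 2 * ?e + 1" for N
  proof -
    define A D where "A = N div 3 + 1" and "D = (2 * ?e + N) div 3"
    define w where "w = real ?q powr (real N / 3)"
    have w1: "w \<ge> 1" unfolding w_def using q2 by (intro ge_one_powr_ge_zero) auto
    have pw: "real ?q ^ n \<le> real ?q ^ m * w" if "3 * n \<le> N + 3 * m" for n m
    proof -
      have "real ?q ^ n = real ?q powr real n" using q2 by (simp add: powr_realpow)
      also have "\<dots> \<le> real ?q powr (real m + real N / 3)"
        using that q2 by (intro powr_mono) linarith+
      also have "\<dots> = real ?q ^ m * w" using q2 by (simp add: powr_add powr_realpow w_def)
      finally show ?thesis .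
    qed
    have "card (solvable_set g \<inter> {h. degree h \<le> N}) \<le>
      ?q ^ (?e + 1) + (\<Sum>d\<le>D. ?q * ((d + 1)\<^sup>2 * ?q ^ d * ?q ^ (A + d - 3 * d)))"
      unfolding A_def D_def by (rule card_solvable_set_le_sum[OF assms])
    also have "(\<Sum>d\<le>D. ?q * ((d + 1)\<^sup>2 * ?q ^ d * ?q ^ (A + d - 3 * d)))
      \<le> (\<Sum>d\<le>D. ?q * (D + 1)\<^sup>2 * (?q ^ d * ?q ^ (A + d - 3 * d)))"
    proof (rule sum_mono)
      fix d assume "d \<in> {..D}"
      then have "(d + 1)\<^sup>2 \<le> (D + 1)\<^sup>2" by (intro power_mono) auto
      then have "?q * ((d + 1)\<^sup>2 * (?q ^ d * ?q ^ (A + d - 3 * d)))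
        \<le> ?q * ((D + 1)\<^sup>2 * (?q ^ d * ?q ^ (A + d - 3 * d)))"
        by (intro mult_left_mono mult_right_mono) auto
      then show "?q * ((d + 1)\<^sup>2 * ?q ^ d * ?q ^ (A + d - 3 * d))
        \<le> ?q * (D + 1)\<^sup>2 * (?q ^ d * ?q ^ (A + d - 3 * d))" by (simp only: mult.assoc)
    qed
    also have "\<dots> = ?q * (D + 1)\<^sup>2 * (\<Sum>d\<le>D. ?q ^ d * ?q ^ (A + d - 3 * d))"
      by (rule sum_distrib_left[symmetric])
    also have "\<dots> \<le> ?q * (D + 1)\<^sup>2 * (?q ^ (A + 1) + ?q ^ (D + 1))"
      by (intro mult_left_mono sum_truncated_powers_le q2) simp
    also have "\<dots> \<le> ?q * (2 * N)\<^sup>2 * (?q ^ (A + 1) + ?q ^ (D + 1))"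
      using N unfolding D_def by (intro mult_right_mono mult_left_mono power_mono) auto
    finally have "real (card (solvable_set g \<inter> {h. degree h \<le> N})) \<le>
      real (?q ^ (?e + 1) + ?q * (2 * N)\<^sup>2 * (?q ^ (A + 1) + ?q ^ (D + 1)))"
      by (simp only: of_nat_le_iff)
    also have "\<dots> = real ?q ^ (?e + 1) * 1 + real ?q * (2 * real N)\<^sup>2 * (real ?q ^ (A + 1) + real ?q ^ (D + 1))"
      by simp
    also have "\<dots> \<le> real ?q ^ (?e + 1) * (real N ^ 2 * w) +
      real ?q * (2 * real N)\<^sup>2 * (real ?q ^ 2 * w + real ?q ^ (2 * ?e + 1) * w)"
    proof (intro add_mono mult_left_mono pw)
      have "real N ^ 2 \<ge> 1" using N by simp
      then show "1 \<le> real N ^ 2 * w" using w1 mult_mono[of 1 "real N ^ 2" 1 w] by simp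
    qed (auto simp: A_def D_def)
    also have "\<dots> = real C * (real N ^ 2 * w)"
      by (simp add: C_def algebra_simps power2_eq_square)
    finally show ?thesis unfolding w_def .
  qed
  then have "\<forall>\<^sub>F N in sequentially. real (card (solvable_set g \<inter> {h. degree h \<le> N}))
    \<le> real C * (real N ^ 2 * real ?q powr (real N / 3))"
    unfolding eventually_sequentially by blast
  moreover have "C > 0" using q2 by (simp add: C_def)
  then have "real C > 0" by simp
  ultimately show ?thesis by blast
qed

section \<open>The lower bound\<close>

lemma exists_monic_prime_square_dvd:
  fixes f :: "'a::field poly"
  assumes "f \<noteq> 0" "\<not> squarefree f"
  obtains P where "prime_elem P" "lead_coeff P = 1" "P\<^sup>2 dvd f"
proof -
  obtain x where x: "x\<^sup>2 dvd f" "\<not> is_unit x"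
    using assms(2) unfolding squarefree_def by blast
  have "x \<noteq> 0" using x(1) assms(1) by auto
  with x(2) have "degree x > 0" by (subst (asm) not_is_unit_iff_degree_pos)
  then obtain P where P: "prime_elem P" "lead_coeff P = 1" "P dvd x"
    by (rule exists_monic_prime_elem_dvd_poly)
  from P(3) have "P\<^sup>2 dvd x\<^sup>2" by (rule dvd_power_same)
  with x(1) P that show thesis using dvd_trans by blast
qed

text \<open>
  Coefficients \<open>G\<close> for which \<open>G z\<^sup>3 + 1\<close> is easy to sieve: the values are coprime to all primes of degree at
  most \<open>3\<close>, and their derivative is \<open>3 G z\<^sup>2 z'\<close>.
\<close>

locale sieve =
  fixes G :: "'a::{field,finite} poly"
  assumes char_neq_3: "CHAR('a) \<noteq> 3"
    and G_nonzero: "G \<noteq> 0"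
    and pderiv_G: "pderiv G = 0"
    and small_dvd: "\<And>r. r \<noteq> 0 \<Longrightarrow> degree r \<le> 3 \<Longrightarrow> r dvd G"
begin

definition val :: "'a poly \<Rightarrow> 'a poly" where
  "val z = G * z ^ 3 + 1"

lemma prime_dvd_val:
  assumes "prime_elem P" "P dvd val z"
  shows "\<not> P dvd G" "\<not> P dvd z" "degree P > 3"
proof -
  have P: "\<not> P dvd 1" using assms(1) by (simp add: prime_elem_def)
  have "P dvd val z - G * z ^ 3 \<Longrightarrow> False" using P by (simp add: val_def)
  then have n: "\<not> P dvd G * z ^ 3" using assms(2) dvd_diff by blast
  then show 1: "\<not> P dvd G" by (meson dvd_mult2)
  show "\<not> P dvd z" using n by (auto simp: power3_eq_cube)
  show "degree P > 3"
    using small_dvd[OF prime_elem_not_zeroI[OF assms(1)]] 1 by (meson linorder_not_less)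
qed

definition small_bad :: "nat \<Rightarrow> 'a poly set" where
  "small_bad m = {z \<in> monics m. \<exists>P. prime_elem P \<and> lead_coeff P = 1 \<and> 2 * degree P \<le> m \<and> P\<^sup>2 dvd val z}"

definition large_bad :: "nat \<Rightarrow> 'a poly set" where
  "large_bad m = {z \<in> monics m. \<exists>P. prime_elem P \<and> lead_coeff P = 1 \<and> m < 2 * degree P \<and> P\<^sup>2 dvd val z}"

lemma val_nonzero: "val z \<noteq> 0"
proof
  assume "val z = 0"
  have "[:0, 1:] dvd G" by (rule small_dvd) auto
  then have "[:0, 1:] dvd val z - G * z ^ 3" using \<open>val z = 0\<close> by simp
  then have "[:0, 1:] dvd (1 :: 'a poly)" by (simp add: val_def)
  then show False by (simp add: is_unit_pCons_iff)
qed

lemma not_squarefree_val: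
  assumes "z \<in> monics m" "\<not> squarefree (val z)"
  shows "z \<in> small_bad m \<union> large_bad m"
proof -
  obtain P where "prime_elem P" "lead_coeff P = 1" "P\<^sup>2 dvd val z"
    using exists_monic_prime_square_dvd[OF val_nonzero assms(2)] by blast
  with assms(1) show ?thesis unfolding small_bad_def large_bad_def
    by (cases "2 * degree P \<le> m") auto
qed

lemma card_square_dvd_val_le:
  assumes "prime_elem P"
  shows "card {z \<in> monics m. P\<^sup>2 dvd val z} \<le> 3 * CARD('a) ^ (m - 2 * degree P)"
proof -
  let ?t = "monom 1 m :: 'a poly"
  let ?S = "{w \<in> polys_below m. P\<^sup>2 dvd val (?t + w)}"
  have P0: "P \<noteq> 0" using assms by auto
  have "{z \<in> monics m. P\<^sup>2 dvd val z} = (\<lambda>w. ?t + w) ` ?S"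
    unfolding monics_eq by auto
  then have "card {z \<in> monics m. P\<^sup>2 dvd val z} \<le> card ?S"
    using card_image_le[of ?S "\<lambda>w. ?t + w"] finite_subset[of ?S "polys_below m"] by auto
  also have "\<dots> \<le> 3 * CARD('a) ^ (m - degree (P\<^sup>2))"
  proof (rule card_residue_classes_le[where a = ?t])
    fix U assume U: "U \<subseteq> ?S" "inj_on (\<lambda>z. (?t + z) mod P\<^sup>2) U"
    have "finite ((\<lambda>z. ?t + z) ` U) \<and> card ((\<lambda>z. ?t + z) ` U) \<le> 3"
    proof (rule card_cube_solutions_prime_power[OF char_neq_3 assms])
      show "is_unit (- 1 :: 'a poly)" by simp
      show "P\<^sup>2 dvd G * x ^ 3 - - 1" if "x \<in> (\<lambda>z. ?t + z) ` U" for x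
        using that U(1) by (auto simp: val_def)
      show "inj_on (\<lambda>x. x mod P\<^sup>2) ((\<lambda>z. ?t + z) ` U)"
        using U(2) by (auto simp: inj_on_def)
    qed
    then show "card U \<le> 3" by (simp add: card_image)
  qed (use P0 in auto)
  also have "degree (P\<^sup>2) = 2 * degree P" using P0 by (simp add: degree_power_eq)
  finally show ?thesis .
qed

text \<open>
  A union bound: there are at most \<open>q^d\<close> primes of degree \<open>d\<close>, each responsible for at most
  \<open>3 q^(m - 2 d)\<close> polynomials, and the sum of \<open>3 q^(m - d)\<close> over \<open>d \<ge> 4\<close> is at most \<open>3 q^(m - 3)\<close>. The restriction to
  \<open>d \<ge> 4\<close> is what keeps this below \<open>q^m\<close> even for \<open>q = 2\<close>.
\<close>

lemma card_small_bad:
  assumes "m \<ge> 3"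
  shows "8 * card (small_bad m) \<le> 3 * CARD('a) ^ m"
proof -
  let ?q = "CARD('a)"
  have q2: "?q \<ge> 2" by (rule CARD_ge_2)
  let ?I = "{d. 4 \<le> d \<and> 2 * d \<le> m}"
  have finI: "finite ?I" by (rule finite_subset[of _ "{..m}"]) auto
  let ?M = "\<lambda>d. {P \<in> monics d. prime_elem (P :: 'a poly)}"
  let ?S = "\<lambda>P. {z \<in> monics m. P\<^sup>2 dvd val z}"
  have "small_bad m \<subseteq> (\<Union>d\<in>?I. \<Union>P\<in>?M d. ?S P)"
  proof
    fix z assume "z \<in> small_bad m"
    then obtain P where P: "z \<in> monics m" "prime_elem P" "lead_coeff P = 1" "2 * degree P \<le> m" "P\<^sup>2 dvd val z"
      unfolding small_bad_def by blast
    have "P dvd val z" using P(5) by (simp add: power2_eq_square dvd_mult_left)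
    from prime_dvd_val(3)[OF P(2) this] have "degree P \<in> ?I" using P(4) by simp
    moreover have "P \<in> ?M (degree P)" using P by (simp add: monics_def)
    moreover have "z \<in> ?S P" using P by simp
    ultimately show "z \<in> (\<Union>d\<in>?I. \<Union>P\<in>?M d. ?S P)" by blast
  qed
  then have "card (small_bad m) \<le> card (\<Union>d\<in>?I. \<Union>P\<in>?M d. ?S P)"
    by (rule card_mono[rotated]) (use finI in auto)
  also have "\<dots> \<le> (\<Sum>d\<in>?I. \<Sum>P\<in>?M d. card (?S P))"
    by (rule order_trans[OF card_UN_le[OF finI] sum_mono]) (auto intro: card_UN_le)
  also have "\<dots> \<le> (\<Sum>d\<in>?I. 3 * ?q ^ (m - d))"
  proof (rule sum_mono)
    fix d assume d: "d \<in> ?I"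
    have "(\<Sum>P\<in>?M d. card (?S P)) \<le> (\<Sum>P\<in>?M d. 3 * ?q ^ (m - 2 * d))"
      using card_square_dvd_val_le by (intro sum_mono) (auto simp: monics_def)
    also have "\<dots> = card (?M d) * (3 * ?q ^ (m - 2 * d))" by simp
    also have "\<dots> \<le> ?q ^ d * (3 * ?q ^ (m - 2 * d))"
      using card_mono[of "monics d" "?M d"] by (intro mult_right_mono) (auto simp: card_monics)
    also have "\<dots> = 3 * ?q ^ (d + (m - 2 * d))" by (simp add: power_add)
    also have "d + (m - 2 * d) = m - d" using d by simp
    finally show "(\<Sum>P\<in>?M d. card (?S P)) \<le> 3 * ?q ^ (m - d)" .
  qed
  also have "\<dots> = 3 * (\<Sum>d\<in>?I. ?q ^ (m - d))" by (simp add: sum_distrib_left)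
  also have "(\<Sum>d\<in>?I. ?q ^ (m - d)) \<le> ?q ^ (m - 3)"
  proof (cases "m \<ge> 4")
    case True
    have "(\<Sum>d\<in>?I. ?q ^ (m - d)) \<le> (\<Sum>d\<in>{4..m}. ?q ^ (m - d))"
      by (rule sum_mono2) auto
    also have "\<dots> = (\<Sum>i\<le>m - 4. ?q ^ i)"
      by (rule sum.reindex_bij_witness[of _ "\<lambda>i. m - i" "\<lambda>d. m - d"]) (use True in auto)
    also have "\<dots> \<le> ?q ^ (m - 4 + 1)" using q2 by (rule sum_powers_le)
    also have "m - 4 + 1 = m - 3" using True by simp
    finally show ?thesis .
  next
    case False
    then have "?I = {}" by auto
    then show ?thesis by (simp only: sum.empty)
  qed
  finally have "8 * card (small_bad m) \<le> 3 * (2 ^ 3 * ?q ^ (m - 3))" by simp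
  also have "\<dots> \<le> 3 * (?q ^ 3 * ?q ^ (m - 3))"
    by (intro mult_left_mono mult_right_mono power_mono q2) auto
  also have "?q ^ 3 * ?q ^ (m - 3) = ?q ^ m" using assms by (simp flip: power_add)
  finally show ?thesis .
qed

lemma pderiv_val: "pderiv (val z) = G * (3 * z\<^sup>2 * pderiv z)"
proof -
  have "smult 3 (z\<^sup>2) = 3 * z\<^sup>2" by (simp add: numeral_poly)
  then show ?thesis by (simp add: val_def pderiv_add pderiv_mult pderiv_G pderiv_cube)
qed

lemma square_dvd_val_imp_dvd_pderiv:
  assumes "prime_elem P" "P\<^sup>2 dvd val z"
  shows "P dvd pderiv z"
proof -
  obtain s where s: "val z = P\<^sup>2 * s" using assms(2) by blast
  have "pderiv (val z) = P * (P * pderiv s + s * (2 * pderiv P))"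
    unfolding s by (simp add: pderiv_mult power2_eq_square algebra_simps)
  then have "P dvd G * (3 * z\<^sup>2 * pderiv z)" unfolding pderiv_val by simp
  moreover have "P dvd val z" using s by (simp add: power2_eq_square)
  note prime_dvd_val[OF assms(1) this]
  moreover have "\<not> P dvd 3" by (rule prime_elem_not_dvd_3[OF char_neq_3 assms(1)])
  ultimately show ?thesis using assms(1)
    by (simp add: prime_elem_dvd_mult_iff prime_elem_dvd_power_iff)
qed

lemma large_monic_prime_divisor_unique:
  fixes f :: "'a poly"
  assumes "f \<noteq> 0" "degree f \<le> m"
    and P: "prime_elem P" "lead_coeff P = 1" "m < 2 * degree P" "P dvd f"
    and P': "prime_elem P'" "lead_coeff P' = 1" "m < 2 * degree P'" "P' dvd f"
  shows "P = P'"
proof -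
  obtain s where s: "f = P * s" using P(4) by blast
  have nz: "P \<noteq> 0" "s \<noteq> 0" using s assms(1) by auto
  then have "degree f = degree P + degree s" using s by (simp add: degree_mult_eq)
  then have "degree s < degree P'" using assms(2) P(3) P'(3) by linarith
  then have "\<not> P' dvd s" using nz dvd_imp_degree_le by (metis linorder_not_less)
  then have "P' dvd P" using P'(1,4) s prime_elem_dvd_multD by blast
  then obtain c where c: "P = P' * c" by blast
  have "irreducible P" using P(1) by (rule prime_elem_imp_irreducible)
  from irreducibleD[OF this c] have "is_unit c" using P'(1) by (auto simp: prime_elem_def)
  then obtain k where k: "c = [:k:]" unfolding is_unit_poly_iff by blast
  have "lead_coeff P = lead_coeff P' * lead_coeff c" unfolding c by (rule lead_coeff_mult)
  then have "k = 1" using P(2) P'(2) k by simp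
  then show ?thesis using c k by simp
qed

text \<open>
  All shifts \<open>z + v\<^sup>p\<close> have the derivative \<open>z'\<close>, which is nonzero because \<open>p\<close> does not divide \<open>m\<close> and has
  at most one monic prime divisor \<open>P\<close> of degree above \<open>m / 2\<close>. So all bad shifts are bad because of the same
  \<open>P\<close>. They are incongruent modulo \<open>P\<close>, since
  \<open>v\<^sup>p - w\<^sup>p = (v - w)\<^sup>p\<close> and \<open>deg (v - w) < deg P\<close>, and they are cube roots of a fixed residue.
\<close>

lemma card_large_bad_shifts:
  assumes z: "z \<in> monics m" "\<not> CHAR('a) dvd m"
  shows "card {v \<in> polys_below (m div CHAR('a)). z + v ^ CHAR('a) \<in> large_bad m} \<le> 3"
proof -
  let ?p = "CHAR('a)"
  let ?V = "{v \<in> polys_below (m div ?p). z + v ^ ?p \<in> large_bad m}"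
  have p: "prime ?p" by (rule prime_CHAR_finite)
  have dz: "pderiv (z + v ^ ?p) = pderiv z" for v
    by (simp add: pderiv_add pderiv_power)
  have m0: "m > 0" using z(2) by (cases m) auto
  have "coeff (pderiv z) (m - 1) = of_nat m"
    using z(1) m0 by (auto simp: coeff_pderiv monics_def)
  moreover have "of_nat m \<noteq> (0 :: 'a)" using z(2) by (simp add: of_nat_eq_0_iff_char_dvd)
  ultimately have dz0: "pderiv z \<noteq> 0" by auto
  have ddz: "degree (pderiv z) \<le> m"
    using degree_pderiv_less[of z] dz0 z(1) by (simp add: monics_def)
  have fin: "finite ?V" by (rule finite_subset[of _ "polys_below (m div ?p)"]) auto
  show ?thesis
  proof (cases "?V = {}")
    case False
    then obtain v0 where "v0 \<in> ?V" by blast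
    then obtain P where P: "prime_elem P" "lead_coeff P = 1" "m < 2 * degree P" "P dvd pderiv z"
      using square_dvd_val_imp_dvd_pderiv dz unfolding large_bad_def by fastforce
    let ?T = "(\<lambda>v. z + v ^ ?p) ` ?V"
    have dvd: "P dvd val x" if x: "x \<in> ?T" for x
    proof -
      from x obtain v where v: "x = z + v ^ ?p" "x \<in> large_bad m" by blast
      then obtain P' where P': "prime_elem P'" "lead_coeff P' = 1" "m < 2 * degree P'" "P'\<^sup>2 dvd val x"
        unfolding large_bad_def by blast
      have "P' dvd pderiv z"
        using square_dvd_val_imp_dvd_pderiv[OF P'(1,4)] dz v(1) by simp
      from large_monic_prime_divisor_unique[OF dz0 ddz P P'(1-3) this] P'(4)
      show ?thesis by (simp add: power2_eq_square dvd_mult_left)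
    qed
    have eqI: "v = w" if vw: "v \<in> ?V" "w \<in> ?V" "P dvd (z + v ^ ?p) - (z + w ^ ?p)" for v w
    proof -
      have "v ^ ?p = (v - w) ^ ?p + w ^ ?p" using freshmans_dream_poly[of "v - w" w] by simp
      then have "P dvd (v - w) ^ ?p" using vw(3) by simp
      then have "P dvd v - w" using P(1) prime_elem_dvd_power by blast
      moreover have "v - w \<in> polys_below (m div ?p)" using vw by (auto simp: polys_below_def)
      then have "v - w = 0 \<or> degree (v - w) < m div ?p" by (simp only: polys_below_iff)
      moreover have "m div ?p \<le> m div 2" using prime_ge_2_nat[OF p] by (intro div_le_mono2) auto
      ultimately show "v = w" using P(3) dvd_imp_degree_le[of P "v - w"] by fastforce
    qed
    have "finite ?T \<and> card ?T \<le> 3"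
    proof (rule card_cube_solutions_prime_power[OF char_neq_3 P(1), where k = 1])
      show "is_unit (- 1 :: 'a poly)" by simp
      show "P ^ 1 dvd G * x ^ 3 - - 1" if "x \<in> ?T" for x
        using dvd[OF that] by (simp add: val_def)
      show "inj_on (\<lambda>x. x mod P ^ 1) ?T"
        using eqI by (auto simp: inj_on_def mod_eq_dvd_iff)
    qed
    moreover have "inj_on (\<lambda>v. z + v ^ ?p) ?V"
      using eqI by (auto intro!: inj_onI)
    ultimately show ?thesis by (simp add: card_image)
  qed (simp only: card.empty)
qed

text \<open>
  Double counting of the pairs \<open>(z, v)\<close> for which \<open>z + v\<^sup>p\<close> is bad. For fixed \<open>v\<close> the shift permutes the
  monic polynomials of degree \<open>m\<close>.
\<close>

lemma card_large_bad:
  assumes "\<not> CHAR('a) dvd m"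
  shows "CARD('a) ^ (m div CHAR('a)) * card (large_bad m) \<le> 3 * CARD('a) ^ m"
proof -
  let ?p = "CHAR('a)" and ?q = "CARD('a)"
  let ?V = "polys_below (m div ?p) :: 'a poly set"
  have p: "prime ?p" by (rule prime_CHAR_finite)
  have m0: "m > 0" using assms by (cases m) auto
  have shift: "z + v ^ ?p \<in> monics m" "z - v ^ ?p \<in> monics m" if z: "z \<in> monics m" and v: "v \<in> ?V" for z v
  proof -
    have "v ^ ?p \<in> polys_below m"
    proof (cases "v = 0")
      case False
      then have "degree v < m div ?p" using v by (simp add: polys_below_iff)
      then have "?p * degree v < ?p * (m div ?p)" using prime_gt_0_nat[OF p] by simp
      also have "\<dots> \<le> m" by simp
      finally show ?thesis using False by (simp add: polys_below_iff degree_power_eq)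
    qed (use p prime_gt_0_nat in \<open>simp add: polys_below_def power_0_left\<close>)
    moreover obtain w where "z = monom 1 m + w" "w \<in> polys_below m" using z unfolding monics_eq by blast
    ultimately have "w + v ^ ?p \<in> polys_below m" "w - v ^ ?p \<in> polys_below m"
      "z + v ^ ?p = monom 1 m + (w + v ^ ?p)" "z - v ^ ?p = monom 1 m + (w - v ^ ?p)"
      by (simp_all add: polys_below_def)
    then show "z + v ^ ?p \<in> monics m" "z - v ^ ?p \<in> monics m" unfolding monics_eq by blast+
  qed
  have sub: "large_bad m \<subseteq> monics m" by (auto simp: large_bad_def)
  have "?q ^ (m div ?p) * card (large_bad m) = (\<Sum>v\<in>?V. card (large_bad m))"
    by (simp add: card_polys_below)
  also have "\<dots> = (\<Sum>v\<in>?V. card {z \<in> monics m. z + v ^ ?p \<in> large_bad m})"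
  proof (rule sum.cong[OF refl])
    fix v assume v: "v \<in> ?V"
    have "(\<lambda>z. z - v ^ ?p) ` large_bad m = {z \<in> monics m. z + v ^ ?p \<in> large_bad m}"
      using shift(2)[OF _ v] sub by (auto intro!: image_eqI[of _ _ "_ + v ^ ?p"])
    then have "card {z \<in> monics m. z + v ^ ?p \<in> large_bad m} = card ((\<lambda>z. z - v ^ ?p) ` large_bad m)"
      by (simp only:)
    also have "\<dots> = card (large_bad m)" by (rule card_image) (simp add: inj_on_def)
    finally show "card (large_bad m) = card {z \<in> monics m. z + v ^ ?p \<in> large_bad m}" ..
  qed
  also have "\<dots> = (\<Sum>z\<in>monics m. card {v \<in> ?V. z + v ^ ?p \<in> large_bad m})"
    by (rule sum_multicount_gen) (auto)
  also have "\<dots> \<le> (\<Sum>z\<in>(monics m :: 'a poly set). 3)"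
    by (rule sum_mono) (rule card_large_bad_shifts[OF _ assms])
  also have "\<dots> = 3 * ?q ^ m" by (simp add: card_monics)
  finally show ?thesis .
qed

lemma card_squarefree_values:
  assumes "\<not> CHAR('a) dvd m" "m \<ge> 5 * CHAR('a)"
  shows "CARD('a) ^ m \<le> 2 * card {z \<in> monics m. squarefree (val z)}"
proof -
  let ?q = "CARD('a)" and ?p = "CHAR('a)"
  have p: "prime ?p" by (rule prime_CHAR_finite)
  have q2: "?q \<ge> 2" by (rule CARD_ge_2)
  have p2: "?p \<ge> 2" using p by (rule prime_ge_2_nat)
  have "monics m \<subseteq> {z \<in> monics m. squarefree (val z)} \<union> (small_bad m \<union> large_bad m)"
    using not_squarefree_val by blast
  moreover have "finite (small_bad m)" "finite (large_bad m)"
    by (rule finite_subset[of _ "monics m"]; auto simp: small_bad_def large_bad_def)+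
  ultimately have "card (monics m :: 'a poly set) \<le> card ({z \<in> monics m. squarefree (val z)} \<union> (small_bad m \<union> large_bad m))"
    by (intro card_mono) auto
  also have "\<dots> \<le> card {z \<in> monics m. squarefree (val z)} + (card (small_bad m) + card (large_bad m))"
    by (rule order_trans[OF card_Un_le]) (intro add_left_mono card_Un_le)
  finally have 1: "?q ^ m \<le> card {z \<in> monics m. squarefree (val z)} + (card (small_bad m) + card (large_bad m))"
    by (simp add: card_monics)
  have 2: "8 * card (small_bad m) \<le> 3 * ?q ^ m"
    by (rule card_small_bad) (use assms(2) p2 in linarith)
  \<comment> \<open>\<open>m \<ge> 5 p\<close> yields at least \<open>2^5\<close> shifts, so that the bad proportions are at most \<open>3/8\<close> and \<open>3/32\<close>, less than \<open>1/2\<close> in total.\<close>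
  have "5 \<le> m div ?p" using assms(2) p2 by (simp add: less_eq_div_iff_mult_less_eq)
  then have "(2 :: nat) ^ 5 \<le> ?q ^ (m div ?p)"
    using q2 power_increasing[of 5 "m div ?p" "2 :: nat"] power_mono[of 2 ?q "m div ?p"] by linarith
  then have "2 ^ 5 * card (large_bad m) \<le> ?q ^ (m div ?p) * card (large_bad m)" by (rule mult_right_mono) simp
  also have "\<dots> \<le> 3 * ?q ^ m" by (rule card_large_bad[OF assms(1)])
  finally have "32 * card (large_bad m) \<le> 3 * ?q ^ m" by simp
  with 1 2 show ?thesis by linarith
qed

end

lemma cube_inj_on_monics:
  fixes z w :: "'a::field poly"
  assumes "CHAR('a) \<noteq> 3" "z \<in> monics m" "w \<in> monics m" "z ^ 3 = w ^ 3"
  shows "z = w"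
proof (rule ccontr)
  assume "z \<noteq> w"
  moreover have "(z - w) * (z * z + z * w + w * w) = z ^ 3 - w ^ 3"
    by (simp add: algebra_simps power3_eq_cube)
  ultimately have 0: "z * z + z * w + w * w = 0" using assms(4) by simp
  have "coeff (z * z) (m + m) = 1" "coeff (z * w) (m + m) = 1" "coeff (w * w) (m + m) = 1"
    using coeff_mult_degree_sum[of z z] coeff_mult_degree_sum[of z w] coeff_mult_degree_sum[of w w]
      assms(2,3) by (auto simp: monics_def)
  then have "coeff (z * z + z * w + w * w) (m + m) = 3" by simp
  with 0 three_neq_0[OF assms(1)] show False by simp
qed

text \<open>
  With \<open>p\<^sup>2 = 3 j + 1\<close> the choice \<open>Q = g^j R^p\<close> gives \<open>g Q\<^sup>3 = (g^p R\<^sup>3)^p\<close>, whatever \<open>R\<close> is; for \<open>R\<close> take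
  the product of all nonzero polynomials of degree at most \<open>3\<close>.
\<close>

lemma exists_pth_power_cofactor:
  fixes g :: "'a::{field,finite} poly"
  assumes "CHAR('a) \<noteq> 3" "g \<noteq> 0"
  obtains Q where "sieve (g * Q ^ 3)" "Q \<noteq> 0"
proof -
  let ?p = "CHAR('a)"
  have p: "prime ?p" by (rule prime_CHAR_finite)
  obtain j where pp: "?p * ?p = j * 3 + 1"
    using not_3_dvd_CHAR[OF assms(1)] by (rule square_eq_1_mod_3)
  define R where "R = \<Prod>(polys_below 4 - {0 :: 'a poly})"
  define Q where "Q = g ^ j * R ^ ?p"
  have R0: "R \<noteq> 0" unfolding R_def by (simp add: prod_zero_iff)
  have "g * Q ^ 3 = g ^ (j * 3 + 1) * R ^ (3 * ?p)"
    by (simp add: Q_def power_mult_distrib power_add mult_ac flip: power_mult)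
  also have "\<dots> = (g ^ ?p * R ^ 3) ^ ?p"
    unfolding pp[symmetric] by (simp add: power_mult power_mult_distrib)
  finally have G: "g * Q ^ 3 = (g ^ ?p * R ^ 3) ^ ?p" .
  have "sieve (g * Q ^ 3)"
  proof
    show "?p \<noteq> 3" by fact
    show "g * Q ^ 3 \<noteq> 0" using assms(2) R0 by (simp add: Q_def)
    show "pderiv (g * Q ^ 3) = 0" unfolding G by (simp add: pderiv_power)
    fix r :: "'a poly" assume r: "r \<noteq> 0" "degree r \<le> 3"
    then have "r \<in> polys_below 4 - {0}" by (simp add: polys_below_iff)
    then have "r dvd R" unfolding R_def by (intro dvd_prodI) auto
    also have "R dvd Q" using prime_gt_0_nat[OF p] by (simp add: Q_def dvd_power)
    also have "Q dvd g * Q ^ 3" by (simp add: power3_eq_cube)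
    finally show "r dvd g * Q ^ 3" .
  qed
  moreover have "Q \<noteq> 0" using assms(2) R0 by (simp add: Q_def)
  ultimately show thesis by (rule that)
qed

text \<open>
  The square-free values of \<open>G z\<^sup>3 + 1\<close> with \<open>G = g Q\<^sup>3\<close> belong to the set by the solution \<open>(Q z, 1)\<close>, and
  different monic \<open>z\<close> of the same degree give different values.
\<close>

lemma solvable_set_lower_bound:
  fixes g :: "'a::{field,finite} poly"
  assumes "CHAR('a) \<noteq> 3" "g \<noteq> 0"
  shows "\<exists>C>0. \<forall>\<^sub>F N in sequentially. real CARD('a) powr (real N / 3)
    \<le> C * real (card (solvable_set g \<inter> {h. degree h \<le> N}))"
proof -
  let ?p = "CHAR('a)" and ?q = "CARD('a)"
  have p: "prime ?p" by (rule prime_CHAR_finite)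
  have q2: "?q \<ge> 2" by (rule CARD_ge_2)
  obtain Q where Q: "sieve (g * Q ^ 3)" "Q \<noteq> 0"
    using exists_pth_power_cofactor[OF assms] .
  define e where "e = degree (g * Q ^ 3)"
  interpret sieve "g * Q ^ 3" by (rule Q)
  define C where "C = 2 * real ?q ^ (e + 5)"
  have "real ?q powr (real N / 3) \<le> C * real (card (solvable_set g \<inter> {h. degree h \<le> N}))"
    if N: "N \<ge> e + 15 * ?p + 6" for N
  proof -
    define n where "n = (N - e) div 3"
    have n: "n \<ge> 5 * ?p + 1" "e + 3 * n \<le> N" "N \<le> e + 3 * n + 2"
      using N unfolding n_def by linarith+
    \<comment> \<open>The sieve needs a degree prime to \<open>p\<close>; one of two consecutive degrees is, at the cost of a constant factor.\<close>
    have "\<exists>m. \<not> ?p dvd m \<and> (m = n \<or> m = n - 1)"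
    proof (rule ccontr)
      assume "\<not> ?thesis"
      then have "?p dvd n" "?p dvd n - 1" by auto
      then have "?p dvd n - (n - 1)" by (rule dvd_diff_nat)
      moreover have "n - (n - 1) = 1" using n by simp
      ultimately show False using p by simp
    qed
    then obtain m where m: "\<not> ?p dvd m" "m = n \<or> m = n - 1" by blast
    then have m5: "m \<ge> 5 * ?p" "e + 3 * m \<le> N" "N \<le> e + 3 * m + 5" using n by auto
    let ?Z = "{z \<in> monics m. squarefree (val z)}"
    have "?q ^ m \<le> 2 * card ?Z" by (rule card_squarefree_values[OF m(1) m5(1)])
    also have "card ?Z = card (val ` ?Z)"
    proof (rule card_image[symmetric], rule inj_onI)
      fix z w assume zw: "z \<in> ?Z" "w \<in> ?Z" "val z = val w"
      then have "z ^ 3 = w ^ 3" using assms(2) Q(2) by (simp add: val_def)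
      with zw cube_inj_on_monics[OF assms(1)] show "z = w" by blast
    qed
    also have "\<dots> \<le> card (solvable_set g \<inter> {h. degree h \<le> N})"
    proof (rule card_mono)
      show "finite (solvable_set g \<inter> {h. degree h \<le> N})"
        by (rule finite_subset[of _ "polys_below (Suc N)"]) (auto simp: polys_below_iff)
      show "val ` ?Z \<subseteq> solvable_set g \<inter> {h. degree h \<le> N}"
      proof (rule image_subsetI)
        fix z assume z: "z \<in> ?Z"
        have "coprime g (val z)"
        proof (rule coprimeI)
          fix c assume "c dvd g" "c dvd val z"
          then have "c dvd val z - g * (Q ^ 3 * z ^ 3)" by (intro dvd_diff) auto
          then show "is_unit c" by (simp add: val_def mult.assoc)
        qed
        moreover have "g * (Q * z) ^ 3 - val z * 1 ^ 3 = - 1"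
          by (simp add: val_def power_mult_distrib mult.assoc)
        then have "is_unit (g * (Q * z) ^ 3 - val z * 1 ^ 3)" by simp
        moreover have "degree (val z) \<le> N"
        proof -
          have "degree (g * Q ^ 3 * z ^ 3) \<le> e + 3 * m"
            unfolding e_def using z degree_mult_le[of "g * Q ^ 3" "z ^ 3"] degree_power_le[of z 3]
            by (simp add: monics_def)
          then show ?thesis unfolding val_def using m5(2) by (intro degree_add_le) auto
        qed
        ultimately show "val z \<in> solvable_set g \<inter> {h. degree h \<le> N}"
          using z unfolding solvable_set_def by blast
      qed
    qed
    finally have le: "?q ^ m \<le> 2 * card (solvable_set g \<inter> {h. degree h \<le> N})" by simp
    have "real ?q powr (real N / 3) \<le> real ?q powr (real (e + 5) + real m)"
      using m5(3) q2 by (intro powr_mono) linarith+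
    also have "\<dots> = real ?q ^ (e + 5) * real (?q ^ m)"
      using q2 by (simp only: powr_add) (simp add: powr_realpow del: power_Suc of_nat_add)
    also have "\<dots> \<le> real ?q ^ (e + 5) * real (2 * card (solvable_set g \<inter> {h. degree h \<le> N}))"
      using le by (intro mult_left_mono) (simp_all only: of_nat_le_iff, simp)
    finally show ?thesis by (simp add: C_def mult_ac)
  qed
  then have "\<forall>\<^sub>F N in sequentially. real ?q powr (real N / 3)
    \<le> C * real (card (solvable_set g \<inter> {h. degree h \<le> N}))"
    unfolding eventually_sequentially by blast
  moreover have "C > 0" using q2 by (simp add: C_def)
  ultimately show ?thesis by blast
qed

section \<open>Counting monogenic fields\<close>

theorem theorem1p7:
  fixes g :: "'a::{field, finite} poly"
  assumes "CHAR('a) \<noteq> 3"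
    and "degree g > 0"
    and "lead_coeff g = 1"
    and "squarefree g"
  shows "(\<exists>C > 0. \<forall>\<^sub>F N in sequentially.
            real CARD('a) powr (real N / 3)
              \<le> C * real (card (monogenic_set g \<inter> {h. degree h \<le> N}))) \<and>
         (\<exists>C > 0. \<forall>\<^sub>F N in sequentially.
            real (card (monogenic_set g \<inter> {h. degree h \<le> N}))
              \<le> C * (real N ^ 2 * real CARD('a) powr (real N / 3)))"
proof -
  have eq: "monogenic_set g = solvable_set g"
    unfolding solvable_set_def by (rule monogenic_set_eq[OF assms(1,2,4)])
  have "g \<noteq> 0" using assms(2) by auto
  then show ?thesis
    unfolding eq
    using solvable_set_lower_bound[OF assms(1)] solvable_set_upper_bound[OF assms(1,4,2)] by blast
qed

end
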